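(* For all $\alpha>2$, for every positive (smooth) function $f$ on $\mathbf{SU}(2)$ and every $t>0$, the following holds at every point of $\mathbf{SU}(2)$: $$\Gamma(\ln P_tf)+\frac{t}{\alpha}(Z\ln P_tf)^2\le\left(\frac{3\alpha-1}{\alpha-1}-\frac{2t}{\alpha}\right)\frac{\mathcal LP_tf}{P_tf}+\frac{t}{\alpha}-\frac{3\alpha-1}{\alpha-1}+\frac{(3\alpha-1)^2}{\alpha-2}\,\frac1t .$$
   Context: $\mathbf{SU}(2)$ is the group of $2\times2$ complex unitary matrices of determinant $1$. Let $X,Y,Z$ be the left-invariant vector fields on $\mathbf{SU}(2)$ corresponding to the elements $\begin{pmatrix}0&1\\-1&0\end{pmatrix}$, $\begin{pmatrix}0&i\\i&0\end{pmatrix}$, $\begin{pmatrix}i&0\\0&-i\end{pmatrix}$ of its Lie algebra; they satisfy $[Z,X]=2Y$, $[X,Y]=2Z$, $[Y,Z]=2X$. Put $\mathcal L=X^2+Y^2$ (a subelliptic operator) and let $P_t=e^{t\mathcal L}$, $t\ge0$, be the associated heat semigroup. For smooth $g$, $\Gamma(g)=\Gamma(g,g)=(Xg)^2+(Yg)^2$. *)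

theory Defs
  imports "HOL-Analysis.Analysis"
begin

section \<open>The group SU(2)\<close>

definition conj_transpose :: "complex^2^2 \<Rightarrow> complex^2^2" where
  "conj_transpose U = map_matrix cnj (transpose U)"

definition SU2 :: "(complex^2^2) set" where
  "SU2 = {U. conj_transpose U ** U = mat 1 \<and> U ** conj_transpose U = mat 1 \<and> det U = 1}"

lemma conj_transpose_mult: "conj_transpose (U ** V) = conj_transpose V ** conj_transpose U"
  by (simp add: conj_transpose_def vec_eq_iff transpose_def matrix_matrix_mult_def mult.commute)

lemma conj_transpose_mat_1 [simp]: "conj_transpose (mat 1) = mat 1"
  by (simp add: conj_transpose_def vec_eq_iff transpose_def mat_def)

lemma mat_1_in_SU2: "mat 1 \<in> SU2"
  by (simp add: SU2_def)

lemma mult_in_SU2: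
  assumes "U \<in> SU2" and "V \<in> SU2"
  shows "U ** V \<in> SU2"
proof -
  have "conj_transpose V ** conj_transpose U ** (U ** V)
      = conj_transpose V ** (conj_transpose U ** U) ** V"
    by (simp add: matrix_mul_assoc)
  moreover have "U ** V ** (conj_transpose V ** conj_transpose U)
      = U ** (V ** conj_transpose V) ** conj_transpose U"
    by (simp add: matrix_mul_assoc)
  ultimately show ?thesis
    using assms by (simp add: SU2_def conj_transpose_mult det_mul)
qed

typedef su2 = SU2
  using mat_1_in_SU2 by blast

setup_lifting type_definition_su2

instantiation su2 :: times
begin
lift_definition times_su2 :: "su2 \<Rightarrow> su2 \<Rightarrow> su2" is "(**)"
  by (rule mult_in_SU2)
instance ..
end

text \<open>The topology is the subspace topology, given by the metric of the ambient matrix space.\<close>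

instantiation su2 :: metric_space
begin
definition dist_su2 :: "su2 \<Rightarrow> su2 \<Rightarrow> real" where
  "dist_su2 x y = dist (Rep_su2 x) (Rep_su2 y)"
definition uniformity_su2 :: "(su2 \<times> su2) filter" where
  "uniformity_su2 = (INF e\<in>{0 <..}. principal {(x, y). dist x y < e})"
definition open_su2 :: "su2 set \<Rightarrow> bool" where
  "open_su2 U \<longleftrightarrow> (\<forall>x\<in>U. \<forall>\<^sub>F (x', y) in uniformity. x' = x \<longrightarrow> y \<in> U)"
instance
  by standard
    (auto simp: dist_su2_def uniformity_su2_def open_su2_def Rep_su2_inject dist_triangle2)
end

section \<open>Left-invariant vector fields\<close>

text \<open>The power \<open>A ^ n\<close> of the type class \<open>power\<close> is taken entrywise on \<open>complex^2^2\<close>,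
  so the powers of a matrix are iterates of the matrix product.\<close>

definition matrix_exp :: "complex^2^2 \<Rightarrow> complex^2^2" where
  "matrix_exp A = (\<Sum>n. (1 / fact n) *\<^sub>R (((**) A ^^ n) (mat 1)))"

text \<open>The derivation by the left-invariant vector field corresponding to \<open>A\<close>. It is meant for
  \<open>A\<close> in the Lie algebra of SU(2), for which \<open>matrix_exp (s *\<^sub>R A)\<close> lies in \<open>SU2\<close>; for the
  three elements used here see \<open>matrix_exp_su2_in_SU2\<close> below.\<close>

definition left_inv_field :: "complex^2^2 \<Rightarrow> (su2 \<Rightarrow> real) \<Rightarrow> su2 \<Rightarrow> real" where
  "left_inv_field A g x = deriv (\<lambda>s. g (x * Abs_su2 (matrix_exp (s *\<^sub>R A)))) 0"

definition su2_X :: "complex^2^2" where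
  "su2_X = vector [vector [0, 1], vector [-1, 0]]"

definition su2_Y :: "complex^2^2" where
  "su2_Y = vector [vector [0, \<i>], vector [\<i>, 0]]"

definition su2_Z :: "complex^2^2" where
  "su2_Z = vector [vector [\<i>, 0], vector [0, -\<i>]]"

lemma matrix_exp_square_minus_1:
  assumes "A ** A = - mat 1"
  shows "matrix_exp (s *\<^sub>R A) = cos s *\<^sub>R mat 1 + sin s *\<^sub>R A"
proof -
  have step: "s *\<^sub>R A ** (a *\<^sub>R mat 1 + b *\<^sub>R A) = (s * a) *\<^sub>R A - (s * b) *\<^sub>R mat 1" for a b
  proof -
    have "s *\<^sub>R A ** (a *\<^sub>R mat 1 + b *\<^sub>R A) = (s * a) *\<^sub>R A + (s * b) *\<^sub>R (A ** A)"
      by (simp add: vec_eq_iff matrix_matrix_mult_def mat_def sum_2 forall_2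
          scaleR_conv_of_real[where 'a = complex] algebra_simps)
    then show ?thesis by (simp add: assms)
  qed
  have pow: "((**) (s *\<^sub>R A) ^^ n) (mat 1)
      = (fact n * cos_coeff n * s ^ n) *\<^sub>R mat 1 + (fact n * sin_coeff n * s ^ n) *\<^sub>R A" for n
  proof (induction n)
    case 0
    then show ?case by (simp add: cos_coeff_def sin_coeff_def)
  next
    case (Suc n)
    have "((**) (s *\<^sub>R A) ^^ Suc n) (mat 1)
      = (s * (fact n * cos_coeff n * s ^ n)) *\<^sub>R A - (s * (fact n * sin_coeff n * s ^ n)) *\<^sub>R mat 1"
      using Suc.IH step by simp
    moreover have "fact (Suc n) * cos_coeff (Suc n) = - fact n * sin_coeff n"
      and "fact (Suc n) * sin_coeff (Suc n) = fact n * cos_coeff n"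
      by (simp_all add: cos_coeff_Suc sin_coeff_Suc field_simps)
    ultimately show ?case by (simp add: algebra_simps)
  qed
  have "(\<lambda>n. (cos_coeff n *\<^sub>R s ^ n) *\<^sub>R mat 1 + (sin_coeff n *\<^sub>R s ^ n) *\<^sub>R A)
      sums (cos s *\<^sub>R mat 1 + sin s *\<^sub>R A)"
    by (intro sums_add sums_scaleR_left cos_converges sin_converges)
  moreover have "(1 / fact n) *\<^sub>R (((**) (s *\<^sub>R A) ^^ n) (mat 1))
      = (cos_coeff n *\<^sub>R s ^ n) *\<^sub>R mat 1 + (sin_coeff n *\<^sub>R s ^ n) *\<^sub>R A" for n
    by (simp add: pow scaleR_right_distrib)
  ultimately show ?thesis
    unfolding matrix_exp_def by (simp add: sums_unique[symmetric])
qed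

lemma matrix_exp_su2_in_SU2:
  assumes "A \<in> {su2_X, su2_Y, su2_Z}"
  shows "matrix_exp (s *\<^sub>R A) \<in> SU2"
proof -
  note simps = su2_X_def su2_Y_def su2_Z_def vec_eq_iff matrix_matrix_mult_def mat_def sum_2 forall_2
  have "A ** A = - mat 1"
    using assms by (auto simp: simps)
  note e = matrix_exp_square_minus_1[OF this, of s]
  have p: "complex_of_real (cos s) * complex_of_real (cos s)
    = 1 - complex_of_real (sin s) * complex_of_real (sin s)"
    unfolding of_real_mult[symmetric] by (simp add: cos_squared_eq flip: power2_eq_square)
  show ?thesis
    unfolding SU2_def conj_transpose_def e using assms
    by (auto simp: simps transpose_def det_2 scaleR_conv_of_real[where 'a = complex] algebra_simps p)
qed

definition subLaplacian :: "(su2 \<Rightarrow> real) \<Rightarrow> su2 \<Rightarrow> real" where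
  "subLaplacian g x =
     left_inv_field su2_X (left_inv_field su2_X g) x + left_inv_field su2_Y (left_inv_field su2_Y g) x"

definition carre_du_champ :: "(su2 \<Rightarrow> real) \<Rightarrow> su2 \<Rightarrow> real" where
  "carre_du_champ g x = (left_inv_field su2_X g x)\<^sup>2 + (left_inv_field su2_Y g x)\<^sup>2"

section \<open>Smooth functions\<close>

text \<open>\<open>U\<close> is meant to be open.\<close>

primrec Ck_on :: "nat \<Rightarrow> 'a::euclidean_space set \<Rightarrow> ('a \<Rightarrow> real) \<Rightarrow> bool" where
  "Ck_on 0 U F \<longleftrightarrow> continuous_on U F"
| "Ck_on (Suc k) U F \<longleftrightarrow>
     F differentiable_on U \<and> (\<forall>b\<in>Basis. Ck_on k U (\<lambda>x. frechet_derivative F (at x) b))"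

text \<open>Smoothness on the embedded submanifold SU(2) of the matrix space, which is viewed as a
  real vector space of dimension 8: local smooth extendability.\<close>

definition smooth_su2 :: "(su2 \<Rightarrow> real) \<Rightarrow> bool" where
  "smooth_su2 g \<longleftrightarrow>
     (\<forall>x. \<exists>U F. open U \<and> Rep_su2 x \<in> U \<and> (\<forall>k. Ck_on k U F) \<and>
       (\<forall>y. Rep_su2 y \<in> U \<longrightarrow> F (Rep_su2 y) = g y))"

section \<open>The heat semigroup\<close>

instance bcontfun :: (metric_space, banach) banach ..

text \<open>Strongly continuous semigroups of bounded operators; only the values at \<open>t \<ge> 0\<close> matter.\<close>

definition c0_semigroup :: "(real \<Rightarrow> 'a::banach \<Rightarrow> 'a) \<Rightarrow> bool" where
  "c0_semigroup P \<longleftrightarrow>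
     (\<forall>t\<ge>0. bounded_linear (P t)) \<and>
     P 0 = id \<and>
     (\<forall>s\<ge>0. \<forall>t\<ge>0. P (s + t) = P s \<circ> P t) \<and>
     (\<forall>g. ((\<lambda>t. P t g) \<longlongrightarrow> g) (at_right 0))"

text \<open>The infinitesimal generator, as an operator graph.\<close>

definition generator :: "(real \<Rightarrow> 'a::banach \<Rightarrow> 'a) \<Rightarrow> ('a \<times> 'a) set" where
  "generator P = {(g, h). ((\<lambda>t. (P t g - g) /\<^sub>R t) \<longlongrightarrow> h) (at_right 0)}"

text \<open>\<open>P t = exp (t L)\<close> on the Banach space of continuous functions on SU(2) (which is compact, so
  that all continuous functions are bounded): the generator is the closure of the operator \<open>L\<close>
  with domain the smooth functions. A semigroup is determined by its generator, so \<open>P\<close> is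
  unique on \<open>t \<ge> 0\<close>.\<close>

definition heat_semigroup :: "(real \<Rightarrow> (su2 \<Rightarrow>\<^sub>C real) \<Rightarrow> (su2 \<Rightarrow>\<^sub>C real)) \<Rightarrow> bool" where
  "heat_semigroup P \<longleftrightarrow>
     c0_semigroup P \<and>
     generator P = closure {(g, h). smooth_su2 (apply_bcontfun g) \<and>
       apply_bcontfun h = subLaplacian (apply_bcontfun g)}"

end

theory Submission
  imports Defs
begin

text \<open>Write \<open>L = X\<^sup>2 + Y\<^sup>2\<close> and \<open>u = P\<^sub>t f\<close>. The estimate is a consequence of the maximum principle
for the heat equation. Put \<open>a = t\<^sup>\<alpha>\<^sup>-\<^sup>1\<close>, \<open>b = 4 t\<^sup>\<alpha> / \<alpha>\<close>, \<open>\<gamma> = 1 - (3\<alpha> - 1) / (2t)\<close>, let \<open>A\<close> and \<open>B\<close> be the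
primitives of \<open>2a\<gamma>\<close> and \<open>a\<gamma>\<^sup>2\<close> that vanish at \<open>t = 0\<close> (this is where \<open>\<alpha> > 2\<close> enters), and consider
  \<open>G = (a \<Gamma>(u) + b (Z u)\<^sup>2) / u + A L u - B u\<close>.
Then \<open>G = 0\<close> at time \<open>0\<close>, and \<open>G\<close> is a subsolution: \<open>\<partial>\<^sub>t G \<le> L G\<close>. Hence \<open>G \<le> 0\<close>, and division by \<open>a u\<close>
gives a bound that implies the assertion, since its left-hand side contains
\<open>(4t/\<alpha>) (Z ln u)\<^sup>2\<close> and its last term is a quarter of the one in the assertion.

That \<open>G\<close> is a subsolution (\<open>li_yau_parabolic_inequality\<close>) is the curvature-dimension inequality of
the subelliptic structure. In \<open>(\<partial>\<^sub>t - L) G / u\<close> the squared norm of the Hessian of \<open>ln u\<close>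
appears with the factor \<open>-2a\<close>. The diagonal of the Hessian dominates the square of \<open>L ln u\<close>, which
is replaced by a linear expression by means of \<open>\<gamma>\<close>; the skew part is \<open>[X, Y]/2 = Z\<close>, so that it
produces \<open>-4a (Z ln u)\<^sup>2\<close>, which pays for \<open>b' = 4a\<close>. The commutators of \<open>L\<close> with \<open>X\<close> and \<open>Y\<close>
(\<open>heat_deriv_Bochner\<close>) produce products of \<open>X ln u\<close> and \<open>Y ln u\<close> with the horizontal derivatives of
\<open>Z ln u\<close>; these are absorbed by the term \<open>-2b \<Gamma>(Z ln u)\<close> at the cost of \<open>(8a\<^sup>2/b) \<Gamma>(ln u)\<close>, and the
coefficients are such that the total coefficient of \<open>\<Gamma>(ln u)\<close> is negative.

The semigroup is only given through its generator, the closure of \<open>L\<close> on smooth functions, so the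
second task is to show that \<open>u\<close> is a classical solution with enough derivatives. Left
translations preserve \<open>L\<close> and therefore commute with \<open>P\<^sub>t\<close>, by uniqueness for the abstract Cauchy
problem (\<open>abstract_Cauchy_problem_unique\<close>). So \<open>P\<^sub>t f (x)\<close> is the value of a continuous linear
functional, evaluation of \<open>P\<^sub>t\<close> at the identity, on the function \<open>y \<mapsto> f (x y)\<close>, and all
left-invariant derivatives in \<open>x\<close> can be taken under this functional (\<open>heat_deriv_Cons\<close>). Right
translations do not preserve \<open>L\<close>, so \<open>L P\<^sub>t f = P\<^sub>t L f\<close> needs an argument: \<open>L\<close> is the Casimir
operator \<open>X\<^sup>2 + Y\<^sup>2 + Z\<^sup>2\<close>, which is invariant under right translations as well, minus \<open>Z\<^sup>2\<close>, and
\<open>Z\<close> commutes with \<open>P\<^sub>t\<close> because right translation by \<open>exp (s Z)\<close> only rotates \<open>X\<close> and \<open>Y\<close>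
(\<open>heat_deriv_subLaplacian\<close>).\<close>

section \<open>Strongly continuous semigroups\<close>

lemma has_vector_derivative_within_alt:
  "(f has_vector_derivative d) (at x within S) \<longleftrightarrow>
    (\<forall>e>0. \<exists>\<delta>>0. \<forall>y\<in>S. \<bar>y - x\<bar> < \<delta> \<longrightarrow> norm (f y - f x - (y - x) *\<^sub>R d) \<le> e * \<bar>y - x\<bar>)"
  unfolding has_vector_derivative_def has_derivative_within_alt
  by (simp add: bounded_linear_scaleR_left)

lemma c0_semigroupD:
  assumes "c0_semigroup P"
  shows "t \<ge> 0 \<Longrightarrow> bounded_linear (P t)" "P 0 g = g"
    "s \<ge> 0 \<Longrightarrow> t \<ge> 0 \<Longrightarrow> P (s + t) g = P s (P t g)"
    "((\<lambda>t. P t g) \<longlongrightarrow> g) (at_right 0)"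
  using assms by (auto simp: c0_semigroup_def)

text \<open>This is the uniform boundedness principle: the sets of vectors whose orbit stays below \<open>n\<close> on
\<open>[0, 1/(n+1)]\<close> are closed and exhaust the space by strong continuity at \<open>0\<close>, so one of them
contains a ball by Baire's theorem. The semigroup law propagates the bound to \<open>[0, T]\<close>.\<close>

lemma c0_semigroup_locally_bounded:
  fixes P :: "real \<Rightarrow> 'a::banach \<Rightarrow> 'a"
  assumes P: "c0_semigroup P"
  obtains M where "M \<ge> 1" "\<And>t g. 0 \<le> t \<Longrightarrow> t \<le> T \<Longrightarrow> norm (P t g) \<le> M * norm g"
proof -
  note P = c0_semigroupD[OF P]
  define E where "E n = (\<Inter>t\<in>{0..1 / real (Suc n)}. {g. norm (P t g) \<le> real n})" for n
  have clE: "closed (E n)" for n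
    unfolding E_def
    by (intro closed_INT ballI closed_Collect_le continuous_on_norm continuous_on_const
        linear_continuous_on P(1)) auto
  have "\<exists>n. g \<in> E n" for g
  proof -
    have "\<forall>\<^sub>F t in at_right 0. dist (P t g) g < 1"
      using P(4)[of g] by (simp add: tendsto_iff)
    then obtain d where d: "d > 0" "\<And>t. 0 < t \<Longrightarrow> t < d \<Longrightarrow> dist (P t g) g < 1"
      by (auto simp: eventually_at_right_field)
    obtain n where n: "real n \<ge> norm g + 1" "real n \<ge> 1 / d"
      using real_arch_simple[of "max (norm g + 1) (1 / d)"] by auto
    have "1 / real (Suc n) < d"
      using n(2) d(1) by (simp add: field_simps)
    have "norm (P t g) \<le> real n" if "t \<in> {0..1 / real (Suc n)}" for t
    proof (cases "t = 0")
      case True then show ?thesis using n P(2) by simp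
    next
      case False
      then have "dist (P t g) g < 1"
        using that \<open>1 / real (Suc n) < d\<close> by (intro d(2)) auto
      then have "norm (P t g) < norm g + 1"
        by (metis add.commute dist_norm diff_less_eq norm_triangle_ineq2 order_le_less_trans)
      then show ?thesis using n by linarith
    qed
    then show ?thesis unfolding E_def by blast
  qed
  then have un: "\<Union>(range E) = UNIV" by auto
  have "\<exists>n. interior (E n) \<noteq> {}"
  proof (rule ccontr)
    assume "\<not> ?thesis"
    then have "euclidean interior_of \<Union>(range E) = {}"
      using clE by (intro Baire_category_alt) (auto simp: completely_metrizable_space_euclidean)
    then show False using un by simp
  qed
  then obtain n g0 where "g0 \<in> interior (E n)" by auto
  then obtain r where r: "r > 0" "ball g0 r \<subseteq> E n"
    by (meson mem_interior)
  have g0: "g0 \<in> E n" using r by auto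
  define \<delta> where "\<delta> = 1 / real (Suc n)"
  have \<delta>: "\<delta> > 0" by (simp add: \<delta>_def)
  define M where "M = max 1 (4 * real n / r)"
  have M: "norm (P t g) \<le> M * norm g" if t: "0 \<le> t" "t \<le> \<delta>" for t g
  proof (cases "g = 0")
    case True then show ?thesis using P(1)[OF t(1)] by (simp add: linear_simps)
  next
    case False
    define h where "h = (r / (2 * norm g)) *\<^sub>R g"
    have "norm h = r / 2" using r False by (simp add: h_def)
    then have "g0 + h \<in> E n" using r by (auto simp: dist_norm)
    then have 1: "norm (P t (g0 + h)) \<le> n" using t by (auto simp: E_def \<delta>_def)
    have 2: "norm (P t g0) \<le> n" using g0 t by (auto simp: E_def \<delta>_def)
    have "P t h = P t (g0 + h) - P t g0" using P(1)[OF t(1)] by (simp add: linear_simps)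
    moreover have "norm (P t (g0 + h) - P t g0) \<le> 2 * real n"
      using 1 2 norm_triangle_ineq4[of "P t (g0 + h)" "P t g0"] by linarith
    ultimately have "norm (P t h) \<le> 2 * real n" by simp
    moreover have "P t h = (r / (2 * norm g)) *\<^sub>R P t g"
      using P(1)[OF t(1)] by (simp add: h_def linear_simps)
    ultimately have "r / (2 * norm g) * norm (P t g) \<le> 2 * n" using r by simp
    then have "norm (P t g) \<le> 4 * n / r * norm g" using r False by (simp add: field_simps)
    also have "\<dots> \<le> M * norm g" by (intro mult_right_mono) (auto simp: M_def)
    finally show ?thesis .
  qed
  have M1: "M \<ge> 1" by (simp add: M_def)
  have Mk: "0 \<le> t \<Longrightarrow> t \<le> real k * \<delta> \<Longrightarrow> norm (P t g) \<le> M ^ k * norm g" for t g k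
  proof (induction k arbitrary: t)
    case 0 then show ?case using P(2) by simp
  next
    case (Suc k)
    show ?case
    proof (cases "t \<le> \<delta>")
      case True
      have "norm (P t g) \<le> M * norm g" using M Suc True by simp
      also have "\<dots> \<le> M ^ Suc k * norm g"
        using M1 self_le_power[of M "Suc k"] by (intro mult_right_mono) auto
      finally show ?thesis .
    next
      case False
      have "P t g = P \<delta> (P (t - \<delta>) g)" using P(3)[of \<delta> "t - \<delta>"] False \<delta> by simp
      also have "norm \<dots> \<le> M * norm (P (t - \<delta>) g)" using \<delta> by (intro M) auto
      also have "\<dots> \<le> M * (M ^ k * norm g)"
        using Suc.IH[of "t - \<delta>"] Suc.prems False M1 by (intro mult_left_mono) (auto simp: algebra_simps)
      finally show ?thesis by simp
    qed
  qed
  obtain k where k: "real k \<ge> T / \<delta>" using real_arch_simple by blast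
  show thesis
  proof (rule that[of "M ^ k"])
    show "M ^ k \<ge> 1" using M1 by (rule one_le_power)
    show "norm (P t g) \<le> M ^ k * norm g" if "0 \<le> t" "t \<le> T" for t g
      using that k \<delta> by (intro Mk) (auto simp: field_simps)
  qed
qed

lemma c0_semigroup_time_difference:
  assumes P: "c0_semigroup P" and M: "\<And>t g. 0 \<le> t \<Longrightarrow> t \<le> T \<Longrightarrow> norm (P t g) \<le> M * norm g"
    and "0 \<le> s" "s \<le> T" "0 \<le> t" "t \<le> T"
  shows "norm (P s g - P t g) \<le> M * norm (P \<bar>s - t\<bar> g - g)"
proof -
  have *: "norm (P s g - P t g) \<le> M * norm (P (s - t) g - g)"
    if "0 \<le> t" "t \<le> s" "s \<le> T" for s t
  proof -
    have "P s g = P t (P (s - t) g)" using c0_semigroupD(3)[OF P, of t "s - t" g] that by simp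
    then have "P s g - P t g = P t (P (s - t) g - g)"
      using c0_semigroupD(1)[OF P that(1)] by (simp add: linear_simps)
    then show ?thesis using M[of t] that by simp
  qed
  show ?thesis
    using *[of t s] *[of s t] assms by (cases "t \<le> s") (auto simp: norm_minus_commute)
qed

lemma c0_semigroup_continuous_on:
  fixes P :: "real \<Rightarrow> 'a::banach \<Rightarrow> 'a"
  assumes P: "c0_semigroup P"
  shows "continuous_on ({0..} \<times> UNIV) (\<lambda>(t, g). P t g)"
proof (clarsimp simp: continuous_on_iff)
  fix t :: real and g :: 'a and e :: real assume t: "0 \<le> t" and e: "0 < e"
  obtain M where M: "M \<ge> 1" "\<And>s g. 0 \<le> s \<Longrightarrow> s \<le> t + 1 \<Longrightarrow> norm (P s g) \<le> M * norm g"
    using c0_semigroup_locally_bounded[OF P] by blast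
  have "\<forall>\<^sub>F s in at_right 0. dist (P s g) g < e / (2 * M)"
    using c0_semigroupD(4)[OF P, of g] e M(1) by (simp add: tendsto_iff)
  then obtain d where d: "d > 0" "\<And>s. 0 < s \<Longrightarrow> s < d \<Longrightarrow> dist (P s g) g < e / (2 * M)"
    by (auto simp: eventually_at_right_field)
  define d' where "d' = min (min d 1) (e / (2 * M))"
  have d': "d' > 0" using d e M by (simp add: d'_def)
  show "\<exists>d>0. \<forall>s\<in>{0..}. \<forall>g'. dist (s, g') (t, g) < d \<longrightarrow> dist (P s g') (P t g) < e"
  proof (intro exI[of _ d'] conjI d' ballI allI impI)
    fix s g' assume s: "s \<in> {0..}" and lt: "dist (s, g') (t, g) < d'"
    have 1: "\<bar>s - t\<bar> < d'" using dist_fst_le[of "(s, g')" "(t, g)"] lt by (simp add: dist_real_def)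
    have 2: "norm (g' - g) < d'" using dist_snd_le[of "(s, g')" "(t, g)"] lt by (simp add: dist_norm)
    have st: "0 \<le> s" "s \<le> t + 1" using 1 s by (auto simp: d'_def)
    have "norm (P \<bar>s - t\<bar> g - g) < e / (2 * M)"
      using d(2)[of "\<bar>s - t\<bar>"] 1 e M c0_semigroupD(2)[OF P]
      by (cases "s = t") (auto simp: dist_norm d'_def)
    then have "M * norm (P \<bar>s - t\<bar> g - g) < e / 2" using M(1) by (simp add: field_simps)
    then have a: "norm (P s g - P t g) < e / 2"
      using c0_semigroup_time_difference[OF P M(2), where T = "t + 1" and s = s and t = t and g = g] st t by simp
    have "P s g' - P s g = P s (g' - g)" using c0_semigroupD(1)[OF P st(1)] by (simp add: linear_simps)
    then have "norm (P s g' - P s g) \<le> M * norm (g' - g)" using M(2)[OF st] by simp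
    also have "\<dots> < M * (e / (2 * M))" using 2 M(1) by (intro mult_strict_left_mono) (auto simp: d'_def)
    also have "\<dots> = e / 2" using M(1) by simp
    finally have b: "norm (P s g' - P s g) < e / 2" .
    show "dist (P s g') (P t g) < e"
      using norm_triangle_ineq[of "P s g' - P s g" "P s g - P t g"] a b by (simp add: dist_norm)
  qed
qed

lemma generator_right_derivative:
  assumes "c0_semigroup P" "(g, h) \<in> generator P" "e > 0"
  obtains d where "d > 0" "\<And>s. 0 \<le> s \<Longrightarrow> s < d \<Longrightarrow> norm (P s g - g - s *\<^sub>R h) \<le> e * s"
proof -
  have "\<forall>\<^sub>F s in at_right 0. dist ((P s g - g) /\<^sub>R s) h < e"
    using assms by (simp add: generator_def tendsto_iff)
  then obtain d where d: "d > 0" "\<And>s. 0 < s \<Longrightarrow> s < d \<Longrightarrow> dist ((P s g - g) /\<^sub>R s) h < e"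
    by (auto simp: eventually_at_right_field)
  have "norm (P s g - g - s *\<^sub>R h) \<le> e * s" if "0 \<le> s" "s < d" for s
  proof (cases "s = 0")
    case False
    have "P s g - g - s *\<^sub>R h = s *\<^sub>R ((P s g - g) /\<^sub>R s - h)"
      using False by (simp add: scaleR_diff_right)
    also have "norm \<dots> = s * norm ((P s g - g) /\<^sub>R s - h)" using that by simp
    also have "\<dots> \<le> s * e"
      using d(2)[of s] that False by (intro mult_left_mono) (auto simp: dist_norm)
    finally show ?thesis by (simp add: mult.commute)
  qed (use c0_semigroupD(2)[OF assms(1)] in simp)
  then show thesis using that d(1) by blast
qed

lemma generator_semigroup:
  assumes P: "c0_semigroup P" and gh: "(g, h) \<in> generator P" and t: "t \<ge> 0"
  shows "(P t g, P t h) \<in> generator P"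
proof -
  have "((\<lambda>s. P t ((P s g - g) /\<^sub>R s)) \<longlongrightarrow> P t h) (at_right 0)"
    using gh by (intro bounded_linear.tendsto[OF c0_semigroupD(1)[OF P t]]) (simp add: generator_def)
  moreover have "\<forall>\<^sub>F s in at_right 0. P t ((P s g - g) /\<^sub>R s) = (P s (P t g) - P t g) /\<^sub>R s"
    using eventually_at_right_less[of 0]
  proof eventually_elim
    case (elim s)
    have "P t (P s g) = P s (P t g)"
      using c0_semigroupD(3)[OF P, where s = s and t = t] c0_semigroupD(3)[OF P, where s = t and t = s] elim t by (simp add: add.commute)
    then show ?case using c0_semigroupD(1)[OF P t] by (simp add: linear_simps)
  qed
  ultimately show ?thesis by (simp add: generator_def tendsto_cong)
qed

text \<open>The generator only controls right derivatives. For the left derivative the orbit is written as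
\<open>P\<^sub>s\<close> applied to an increment over \<open>[0, t - s]\<close>, and the local bound makes \<open>P\<^sub>s\<close> harmless.\<close>

lemma semigroup_has_vector_derivative:
  fixes P :: "real \<Rightarrow> 'a::banach \<Rightarrow> 'a"
  assumes P: "c0_semigroup P" and gh: "(g, h) \<in> generator P" and t: "t \<ge> 0"
  shows "((\<lambda>t. P t g) has_vector_derivative P t h) (at t within {0..})"
  unfolding has_vector_derivative_within_alt
proof (intro allI impI)
  fix e :: real assume e: "e > 0"
  obtain M where M: "M \<ge> 1" "\<And>s g. 0 \<le> s \<Longrightarrow> s \<le> t + 1 \<Longrightarrow> norm (P s g) \<le> M * norm g"
    using c0_semigroup_locally_bounded[OF P] by blast
  have e2: "e / (2 * M) > 0" using e M by simp
  obtain d1 where d1: "d1 > 0"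
    "\<And>s. 0 \<le> s \<Longrightarrow> s < d1 \<Longrightarrow> norm (P s g - g - s *\<^sub>R h) \<le> e / (2 * M) * s"
    using generator_right_derivative[OF P gh e2] by blast
  have "\<forall>\<^sub>F s in at_right 0. dist (P s h) h < e / (2 * M)"
    using c0_semigroupD(4)[OF P, of h] e2 by (simp add: tendsto_iff)
  then obtain d2 where d2: "d2 > 0" "\<And>s. 0 < s \<Longrightarrow> s < d2 \<Longrightarrow> dist (P s h) h < e / (2 * M)"
    by (auto simp: eventually_at_right_field)
  define d where "d = min 1 (min d1 d2)"
  have "norm (P s g - P t g - (s - t) *\<^sub>R P t h) \<le> e * \<bar>s - t\<bar>"
    if s: "s \<ge> 0" "\<bar>s - t\<bar> < d" for s
  proof (cases "t \<le> s")
    case True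
    have bl: "bounded_linear (P t)" using c0_semigroupD(1)[OF P t] .
    have "P s g = P t (P (s - t) g)" using c0_semigroupD(3)[OF P, of t "s - t" g] True t by simp
    then have "P s g - P t g - (s - t) *\<^sub>R P t h = P t (P (s - t) g - g - (s - t) *\<^sub>R h)"
      using bl by (simp add: linear_simps)
    also have "norm \<dots> \<le> M * norm (P (s - t) g - g - (s - t) *\<^sub>R h)" using t by (intro M) auto
    also have "\<dots> \<le> M * (e / (2 * M) * (s - t))"
      using True s M(1) by (intro mult_left_mono d1) (auto simp: d_def)
    also have "\<dots> \<le> e * \<bar>s - t\<bar>" using M(1) e True by simp
    finally show ?thesis .
  next
    case False
    define r where "r = t - s"
    have r: "r > 0" "r < d1" "r < d2" using False s by (auto simp: r_def d_def)
    have bl: "bounded_linear (P s)" using c0_semigroupD(1)[OF P s(1)] .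
    have "P t g = P s (P r g)" "P t h = P s (P r h)"
      using c0_semigroupD(3)[OF P, of s r] s r by (auto simp: r_def)
    then have "P s g - P t g - (s - t) *\<^sub>R P t h
      = P s (- (P r g - g - r *\<^sub>R h) + r *\<^sub>R (P r h - h))"
      using bl by (simp add: linear_simps r_def algebra_simps)
    also have "norm \<dots> \<le> M * norm (- (P r g - g - r *\<^sub>R h) + r *\<^sub>R (P r h - h))"
      using s False by (intro M) auto
    also have "\<dots> \<le> M * (e / (2 * M) * r + r * (e / (2 * M)))"
    proof (intro mult_left_mono)
      have "norm (- (P r g - g - r *\<^sub>R h) + r *\<^sub>R (P r h - h))
        \<le> norm (P r g - g - r *\<^sub>R h) + norm (r *\<^sub>R (P r h - h))"
        by (metis norm_minus_cancel norm_triangle_ineq)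
      also have "\<dots> \<le> e / (2 * M) * r + r * (e / (2 * M))"
      proof (intro add_mono)
        show "norm (r *\<^sub>R (P r h - h)) \<le> r * (e / (2 * M))"
          using mult_left_mono[OF less_imp_le[OF d2(2)[OF r(1,3)]], of r] r by (simp add: dist_norm)
      qed (use r d1(2)[of r] in auto)
      finally show "norm (- (P r g - g - r *\<^sub>R h) + r *\<^sub>R (P r h - h))
        \<le> e / (2 * M) * r + r * (e / (2 * M))" .
    qed (use M in auto)
    also have "\<dots> = e * \<bar>s - t\<bar>" using M(1) r by (simp add: r_def)
    finally show ?thesis .
  qed
  moreover have "d > 0" using d1 d2 by (simp add: d_def)
  ultimately show "\<exists>\<delta>>0. \<forall>y\<in>{0..}. \<bar>y - t\<bar> < \<delta> \<longrightarrow>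
      norm (P y g - P t g - (y - t) *\<^sub>R P t h) \<le> e * \<bar>y - t\<bar>"
    by auto
qed

text \<open>The function \<open>s \<mapsto> P\<^sub>t\<^sub>-\<^sub>s (v s)\<close> has derivative zero and joins \<open>P\<^sub>t (v 0)\<close> to \<open>v t\<close>.\<close>

lemma abstract_Cauchy_problem_unique:
  fixes P :: "real \<Rightarrow> 'a::banach \<Rightarrow> 'a"
  assumes P: "c0_semigroup P" and t: "t \<ge> 0"
    and v: "\<And>s. s \<in> {0..t} \<Longrightarrow> (v s, v' s) \<in> generator P"
    and v': "\<And>s. s \<in> {0..t} \<Longrightarrow> (v has_vector_derivative v' s) (at s within {0..t})"
  shows "v t = P t (v 0)"
proof -
  obtain M where M: "M \<ge> 1" "\<And>s g. 0 \<le> s \<Longrightarrow> s \<le> t \<Longrightarrow> norm (P s g) \<le> M * norm g"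
    using c0_semigroup_locally_bounded[OF P] by blast
  have "((\<lambda>s. P (t - s) (v s)) has_vector_derivative 0) (at s within {0..t})" if s: "s \<in> {0..t}" for s
    unfolding has_vector_derivative_within_alt
  proof (intro allI impI)
    fix e :: real assume e: "e > 0"
    have e3: "e / (3 * M) > 0" "e / 3 > 0" using e M by auto
    obtain d1 where d1: "d1 > 0" "\<And>r. r \<in> {0..t} \<Longrightarrow> \<bar>r - s\<bar> < d1 \<Longrightarrow>
        norm (v r - v s - (r - s) *\<^sub>R v' s) \<le> e / (3 * M) * \<bar>r - s\<bar>"
      using v'[OF s] e3 unfolding has_vector_derivative_within_alt by blast
    have "((\<lambda>t. P t (v s)) has_vector_derivative P (t - s) (v' s)) (at (t - s) within {0..})"
      using s by (intro semigroup_has_vector_derivative P v) auto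
    then obtain d2 where d2: "d2 > 0" "\<And>r. r \<ge> 0 \<Longrightarrow> \<bar>r - (t - s)\<bar> < d2 \<Longrightarrow>
        norm (P r (v s) - P (t - s) (v s) - (r - (t - s)) *\<^sub>R P (t - s) (v' s)) \<le> e / 3 * \<bar>r - (t - s)\<bar>"
      using e3 unfolding has_vector_derivative_within_alt atLeast_iff Ball_def by blast
    have "continuous_on {0..} (\<lambda>r. P r (v' s))"
      by (rule continuous_on_compose2[OF c0_semigroup_continuous_on[OF P], of _ "\<lambda>r. (r, v' s)", simplified])
        (auto intro!: continuous_intros)
    then obtain d3 where d3: "d3 > 0" "\<And>r. r \<ge> 0 \<Longrightarrow> \<bar>r - (t - s)\<bar> < d3 \<Longrightarrow>
        norm (P r (v' s) - P (t - s) (v' s)) < e / 3"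
      using e3 s unfolding continuous_on_iff dist_norm real_norm_def
      by (metis atLeast_iff atLeastAtMost_iff diff_ge_0_iff_ge)
    define d where "d = min d1 (min d2 d3)"
    have "norm (P (t - r) (v r) - P (t - s) (v s)) \<le> e * \<bar>r - s\<bar>"
      if r: "r \<in> {0..t}" "\<bar>r - s\<bar> < d" for r
    proof -
      have bl: "bounded_linear (P (t - r))" using c0_semigroupD(1)[OF P] r by simp
      \<comment> \<open>the increment splits according to the increments of \<open>v\<close> and of the semigroup; \<open>C\<close> arises from evaluating \<open>P\<close> at \<open>t - r\<close> instead of \<open>t - s\<close>\<close>
      define A where "A = P (t - r) (v r - v s - (r - s) *\<^sub>R v' s)"
      define B where "B = P (t - r) (v s) - P (t - s) (v s) - ((t - r) - (t - s)) *\<^sub>R P (t - s) (v' s)"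
      define C where "C = P (t - r) (v' s) - P (t - s) (v' s)"
      have eq: "P (t - r) (v r) - P (t - s) (v s) = A + B + (r - s) *\<^sub>R C"
        unfolding A_def B_def C_def using bl by (simp add: linear_simps algebra_simps)
      have "norm A \<le> M * norm (v r - v s - (r - s) *\<^sub>R v' s)"
        unfolding A_def using r by (intro M) auto
      also have "\<dots> \<le> M * (e / (3 * M) * \<bar>r - s\<bar>)"
        using r M by (intro mult_left_mono d1) (auto simp: d_def)
      also have "\<dots> = e / 3 * \<bar>r - s\<bar>" using M by simp
      finally have A: "norm A \<le> e / 3 * \<bar>r - s\<bar>" .
      have B: "norm B \<le> e / 3 * \<bar>r - s\<bar>"
        unfolding B_def using d2(2)[of "t - r"] r by (auto simp: d_def abs_minus_commute)
      have "norm C \<le> e / 3"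
        unfolding C_def using d3(2)[of "t - r"] r by (auto simp: d_def abs_minus_commute)
      then have C: "norm ((r - s) *\<^sub>R C) \<le> e / 3 * \<bar>r - s\<bar>"
        using mult_right_mono[of "norm C" "e / 3" "\<bar>r - s\<bar>"] by (simp add: mult.commute)
      have "norm (A + B + (r - s) *\<^sub>R C) \<le> norm A + norm B + norm ((r - s) *\<^sub>R C)"
        by (metis add_right_mono norm_triangle_ineq order_trans)
      then show ?thesis using A B C unfolding eq by linarith
    qed
    moreover have "d > 0" using d1 d2 d3 by (simp add: d_def)
    ultimately show "\<exists>\<delta>>0. \<forall>y\<in>{0..t}. \<bar>y - s\<bar> < \<delta> \<longrightarrow>
        norm (P (t - y) (v y) - P (t - s) (v s) - (y - s) *\<^sub>R 0) \<le> e * \<bar>y - s\<bar>"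
      by auto
  qed
  then obtain c where c: "\<And>s. s \<in> {0..t} \<Longrightarrow> P (t - s) (v s) = c"
    using has_vector_derivative_zero_constant[of "{0..t}" "\<lambda>s. P (t - s) (v s)"] by auto
  show ?thesis using c[of 0] c[of t] t c0_semigroupD(2)[OF P] by simp
qed

text \<open>Symmetries of the generator are symmetries of the semigroup: \<open>s \<mapsto> T (P\<^sub>s g)\<close> solves the Cauchy
problem with initial value \<open>T g\<close>.\<close>

lemma semigroup_commute:
  fixes P :: "real \<Rightarrow> 'a::banach \<Rightarrow> 'a"
  assumes P: "c0_semigroup P" and t: "t \<ge> 0" and T: "bounded_linear T"
    and TA: "\<And>g h. (g, h) \<in> generator P \<Longrightarrow> (T g, T h) \<in> generator P"
    and gh: "(g, h) \<in> generator P"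
  shows "T (P t g) = P t (T g)"
proof -
  have "((\<lambda>s. T (P s g)) has_vector_derivative T (P s h)) (at s within {0..t})" if "s \<in> {0..t}" for s
    using that
    by (intro bounded_linear.has_vector_derivative[OF T]
        has_vector_derivative_within_subset[OF semigroup_has_vector_derivative[OF P gh]]) auto
  moreover have "(T (P s g), T (P s h)) \<in> generator P" if "s \<in> {0..t}" for s
    using that by (intro TA generator_semigroup P gh) auto
  ultimately show ?thesis
    using abstract_Cauchy_problem_unique[OF P t, of "\<lambda>s. T (P s g)" "\<lambda>s. T (P s h)"]
      c0_semigroupD(2)[OF P] by simp
qed

section \<open>The group SU(2) and its adjoint action\<close>

text \<open>The elements of SU(2) are the unit quaternions; everything below is computed in these coordinates.\<close>

lemma SU2_entries:
  assumes "U \<in> SU2"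
  shows "U$2$2 = cnj (U$1$1)" "U$2$1 = - cnj (U$1$2)"
    "(cmod (U$1$1))\<^sup>2 + (cmod (U$1$2))\<^sup>2 = 1"
proof -
  have e: "cnj (U$1$1) * U$1$1 + cnj (U$2$1) * U$2$1 = 1"
    "cnj (U$1$1) * U$1$2 + cnj (U$2$1) * U$2$2 = 0"
    "U$1$1 * cnj (U$1$1) + U$1$2 * cnj (U$1$2) = 1"
    "U$1$1 * U$2$2 - U$1$2 * U$2$1 = 1"
    using assms unfolding SU2_def conj_transpose_def
    by (auto simp: vec_eq_iff forall_2 matrix_matrix_mult_def sum_2 transpose_def mat_def det_2)
  have "U$2$2 = (cnj (U$1$1) * U$1$1 + cnj (U$2$1) * U$2$1) * U$2$2" using e(1) by simp
  also have "\<dots> = cnj (U$1$1) * (U$1$1 * U$2$2 - U$1$2 * U$2$1)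
      + U$2$1 * (cnj (U$1$1) * U$1$2 + cnj (U$2$1) * U$2$2)"
    by (simp add: algebra_simps)
  finally show d: "U$2$2 = cnj (U$1$1)" using e by simp
  have "U$1$2 + cnj (U$2$1) = (cnj (U$1$1) * U$1$1 + cnj (U$2$1) * U$2$1) * (U$1$2 + cnj (U$2$1))"
    using e(1) by simp
  also have "\<dots> = U$1$1 * (cnj (U$1$1) * U$1$2 + cnj (U$2$1) * cnj (U$1$1))
      + cnj (U$2$1) * ((cnj (U$1$1) * U$1$1 + cnj (U$2$1) * U$2$1) - (U$1$1 * cnj (U$1$1) - U$1$2 * U$2$1))"
    by (simp add: algebra_simps)
  also have "\<dots> = 0" using e d by simp
  finally have "U$1$2 = - cnj (U$2$1)" by (simp add: add_eq_0_iff2)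
  then show "U$2$1 = - cnj (U$1$2)" by simp
  show "(cmod (U$1$1))\<^sup>2 + (cmod (U$1$2))\<^sup>2 = 1"
    using e(3) by (metis complex_norm_square of_real_add of_real_eq_1_iff)
qed

lemmas Rep_su2_entries = SU2_entries[OF Rep_su2]

definition su2_basis :: "(complex^2^2) set" where
  "su2_basis = {su2_X, su2_Y, su2_Z}"

lemma su2_basis_distinct: "su2_X \<noteq> su2_Y" "su2_X \<noteq> su2_Z" "su2_Y \<noteq> su2_Z"
  by (auto simp: su2_X_def su2_Y_def su2_Z_def vec_eq_iff forall_2)

lemma su2_basis_mem [simp]: "su2_X \<in> su2_basis" "su2_Y \<in> su2_basis" "su2_Z \<in> su2_basis"
  by (auto simp: su2_basis_def)

lemma finite_su2_basis [simp]: "finite su2_basis"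
  by (simp add: su2_basis_def)

lemma sum_su2_basis: "(\<Sum>A\<in>su2_basis. g A) = g su2_X + g su2_Y + g su2_Z"
  using su2_basis_distinct by (simp add: su2_basis_def add.assoc)

lemma su2_basis_square:
  assumes "A \<in> su2_basis"
  shows "A ** A = - mat 1"
  using assms by (auto simp: su2_basis_def su2_X_def su2_Y_def su2_Z_def vec_eq_iff
      matrix_matrix_mult_def mat_def sum_2 forall_2)

definition su2_one :: su2 where "su2_one = Abs_su2 (mat 1)"

lemma Rep_su2_one: "Rep_su2 su2_one = mat 1"
  by (simp add: su2_one_def Abs_su2_inverse mat_1_in_SU2)

lemma su2_mult_one [simp]: "x * su2_one = x" "su2_one * x = x"
  by (simp_all add: Rep_su2_one times_su2.rep_eq flip: Rep_su2_inject)

lemma su2_mult_assoc: "x * y * z = x * (y * (z :: su2))"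
  by (simp add: times_su2.rep_eq matrix_mul_assoc flip: Rep_su2_inject)

text \<open>The flow of the left-invariant field \<open>A\<close> is right multiplication by \<open>su2_exp A s\<close>.\<close>

definition su2_exp :: "complex^2^2 \<Rightarrow> real \<Rightarrow> su2" where
  "su2_exp A s = Abs_su2 (matrix_exp (s *\<^sub>R A))"

lemma Rep_su2_exp:
  assumes "A \<in> su2_basis"
  shows "Rep_su2 (su2_exp A s) = cos s *\<^sub>R mat 1 + sin s *\<^sub>R A"
  using matrix_exp_su2_in_SU2[of A s] assms matrix_exp_square_minus_1[OF su2_basis_square[OF assms], of s]
  by (simp add: su2_exp_def Abs_su2_inverse su2_basis_def)

lemma bounded_linear_matrix_mult_left: "bounded_linear (\<lambda>V :: complex^2^2. U ** V)"
  by (intro linear_conv_bounded_linear[THEN iffD1] linearI)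
    (simp_all add: vec_eq_iff matrix_matrix_mult_def sum_2 forall_2 scaleR_conv_of_real[where 'a = complex] algebra_simps)

lemma bounded_linear_matrix_mult_right: "bounded_linear (\<lambda>V :: complex^2^2. V ** U)"
  by (intro linear_conv_bounded_linear[THEN iffD1] linearI)
    (simp_all add: vec_eq_iff matrix_matrix_mult_def sum_2 forall_2 scaleR_conv_of_real[where 'a = complex] algebra_simps)

lemmas matrix_mult_linear_simps =
  bounded_linear.linear[OF bounded_linear_matrix_mult_left, THEN linear_add]
  bounded_linear.linear[OF bounded_linear_matrix_mult_left, THEN linear_scale]
  bounded_linear.linear[OF bounded_linear_matrix_mult_left, THEN linear_neg]
  bounded_linear.linear[OF bounded_linear_matrix_mult_right, THEN linear_add]
  bounded_linear.linear[OF bounded_linear_matrix_mult_right, THEN linear_scale]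
  bounded_linear.linear[OF bounded_linear_matrix_mult_right, THEN linear_neg]

lemma su2_exp_0 [simp]:
  assumes "A \<in> su2_basis" shows "su2_exp A 0 = su2_one"
  using assms by (simp add: Rep_su2_exp Rep_su2_one flip: Rep_su2_inject)

lemma continuous_on_Rep_su2 [continuous_intros]: "continuous_on S Rep_su2"
  by (auto simp: continuous_on_iff dist_su2_def)

lemma continuous_on_su2I:
  assumes "continuous_on S (\<lambda>z. Rep_su2 (f z))"
  shows "continuous_on S f"
  using assms by (simp add: continuous_on_def tendsto_iff dist_su2_def)

lemma continuous_on_matrix_mult [continuous_intros]:
  fixes f g :: "'b::topological_space \<Rightarrow> complex^2^2"
  assumes "continuous_on S f" "continuous_on S g"
  shows "continuous_on S (\<lambda>z. f z ** g z)"
  unfolding matrix_matrix_mult_def using assms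
  by (intro continuous_intros)

lemma continuous_on_su2_mult [continuous_intros]:
  fixes f g :: "'b::topological_space \<Rightarrow> su2"
  assumes "continuous_on S f" "continuous_on S g"
  shows "continuous_on S (\<lambda>z. f z * g z)"
proof (rule continuous_on_compose2[of UNIV "\<lambda>(x, y). x * y" S "\<lambda>z. (f z, g z)", simplified])
  show "continuous_on UNIV (\<lambda>(x, y). x * (y :: su2))"
    unfolding split_beta
    by (intro continuous_on_su2I)
      (auto simp: times_su2.rep_eq intro!: continuous_intros continuous_on_compose2[OF continuous_on_Rep_su2])
qed (use assms in \<open>auto intro!: continuous_intros\<close>)

lemma continuous_on_su2_exp [continuous_intros]:
  assumes "A \<in> su2_basis" "continuous_on S f"
  shows "continuous_on S (\<lambda>z. su2_exp A (f z))"
  by (rule continuous_on_compose2[of UNIV "su2_exp A" S f, simplified])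
    (use assms in \<open>auto simp: Rep_su2_exp intro!: continuous_on_su2I continuous_intros\<close>)

text \<open>The factor \<open>y\<close> on the right allows one to differentiate right translates of functions.\<close>

lemma Rep_su2_exp_has_vector_derivative:
  assumes "A \<in> su2_basis"
  shows "((\<lambda>s. Rep_su2 (x * su2_exp A s * y)) has_vector_derivative
    Rep_su2 (x * su2_exp A s) ** A ** Rep_su2 y) (at s)"
proof -
  have "((\<lambda>s. cos s *\<^sub>R mat 1 + sin s *\<^sub>R A) has_vector_derivative (- sin s *\<^sub>R mat 1 + cos s *\<^sub>R A)) (at s)"
    by (auto intro!: derivative_eq_intros simp: has_vector_derivative_def fun_eq_iff algebra_simps)
  then have "((\<lambda>s. Rep_su2 x ** (cos s *\<^sub>R mat 1 + sin s *\<^sub>R A) ** Rep_su2 y) has_vector_derivative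
      Rep_su2 x ** (- sin s *\<^sub>R mat 1 + cos s *\<^sub>R A) ** Rep_su2 y) (at s)"
    by (intro bounded_linear.has_vector_derivative[OF bounded_linear_matrix_mult_left]
        bounded_linear.has_vector_derivative[OF bounded_linear_matrix_mult_right])
  moreover have "- sin s *\<^sub>R mat 1 + cos s *\<^sub>R A = Rep_su2 (su2_exp A s) ** A"
    using assms by (simp add: Rep_su2_exp matrix_mult_linear_simps su2_basis_square)
  ultimately show ?thesis
    using assms by (simp add: times_su2.rep_eq Rep_su2_exp matrix_mul_assoc)
qed

lemma continuous_on_conj_transpose: "continuous_on S conj_transpose"
    unfolding conj_transpose_def transpose_def map_matrix_def by (intro continuous_intros)

lemma compact_SU2: "compact SU2"
proof -
  have eq: "SU2 = {U. conj_transpose U ** U = mat 1} \<inter> {U. U ** conj_transpose U = mat 1} \<inter> {U. det U = 1}"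
    by (auto simp: SU2_def)
  have "closed SU2"
    unfolding eq det_2
    by (intro closed_Int closed_Collect_eq continuous_intros continuous_on_conj_transpose)
  moreover have "bounded SU2"
  proof (rule boundedI)
    fix U assume U: "U \<in> SU2"
    have "(cmod (U$1$1))\<^sup>2 \<le> 1" "(cmod (U$1$2))\<^sup>2 \<le> 1"
      using SU2_entries(3)[OF U] by (metis le_add_same_cancel1 le_add_same_cancel2 zero_le_power2)+
    then have 1: "cmod (U$1$1) \<le> 1" "cmod (U$1$2) \<le> 1"
      by (simp_all add: abs_square_le_1)
    have "norm U \<le> (\<Sum>i\<in>UNIV. norm (U$i))" unfolding norm_vec_def by (rule L2_set_le_sum) auto
    also have "\<dots> \<le> (\<Sum>i\<in>UNIV. \<Sum>j\<in>UNIV. norm (U$i$j))"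
      unfolding norm_vec_def by (intro sum_mono L2_set_le_sum) auto
    also have "\<dots> \<le> 4" using 1 SU2_entries[OF U] by (simp add: sum_2)
    finally show "norm U \<le> 4" .
  qed
  ultimately show ?thesis using compact_eq_bounded_closed by blast
qed

lemma compact_UNIV_su2: "compact (UNIV :: su2 set)"
proof -
  have "continuous_on SU2 Abs_su2"
    by (auto simp: continuous_on_iff dist_su2_def Abs_su2_inverse)
  moreover have "UNIV = Abs_su2 ` SU2"
    by (metis Abs_su2_cases UNIV_eq_I image_eqI)
  ultimately show ?thesis using compact_continuous_image compact_SU2 by metis
qed

text \<open>The coordinates of \<open>y\<^sup>-\<^sup>1 A y\<close> in the basis \<open>X, Y, Z\<close>, that is, a matrix entry of the adjoint
representation. The three basis matrices are orthogonal with squared norm \<open>2\<close>.\<close>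

definition ad_coeff :: "complex^2^2 \<Rightarrow> complex^2^2 \<Rightarrow> su2 \<Rightarrow> real" where
  "ad_coeff A B y = ((conj_transpose (Rep_su2 y) ** A ** Rep_su2 y) \<bullet> B) / 2"

lemma continuous_on_ad_coeff [continuous_intros]: 
  assumes "continuous_on S f"
  shows "continuous_on S (\<lambda>z. ad_coeff A B (f z))"
proof -
  have "continuous_on UNIV (ad_coeff A B)"
    unfolding ad_coeff_def
    by (intro continuous_intros continuous_on_compose2[OF continuous_on_conj_transpose[of UNIV]]) auto
  then show ?thesis using assms by (rule continuous_on_compose2) auto
qed

text \<open>In quaternion coordinates these are the entries of the rotation matrix of the unit quaternion
\<open>a + b i + c j + d k\<close>.\<close>

lemma ad_coeff_values:
  assumes "Rep_su2 y $ 1 $ 1 = Complex a b" "Rep_su2 y $ 1 $ 2 = Complex c d"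
  shows
    "ad_coeff su2_X su2_X y = a\<^sup>2 - b\<^sup>2 + c\<^sup>2 - d\<^sup>2" "ad_coeff su2_X su2_Y y = 2 * (c * d - a * b)"
    "ad_coeff su2_X su2_Z y = 2 * (a * d + b * c)"
    "ad_coeff su2_Y su2_X y = 2 * (a * b + c * d)" "ad_coeff su2_Y su2_Y y = a\<^sup>2 - b\<^sup>2 - c\<^sup>2 + d\<^sup>2"
    "ad_coeff su2_Y su2_Z y = 2 * (b * d - a * c)"
    "ad_coeff su2_Z su2_X y = 2 * (b * c - a * d)" "ad_coeff su2_Z su2_Y y = 2 * (a * c + b * d)"
    "ad_coeff su2_Z su2_Z y = a\<^sup>2 + b\<^sup>2 - c\<^sup>2 - d\<^sup>2"
    "a\<^sup>2 + b\<^sup>2 + c\<^sup>2 + d\<^sup>2 = 1"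
  unfolding ad_coeff_def conj_transpose_def su2_X_def su2_Y_def su2_Z_def
  using assms Rep_su2_entries[of y]
  by (simp_all add: matrix_matrix_mult_def transpose_def sum_2 inner_vec_def inner_complex_def 
     power2_eq_square algebra_simps cmod_def complex_eq_iff) (simp_all add: field_simps)

lemma ad_coeff_expansion:
  assumes "A \<in> su2_basis"
  shows "A ** Rep_su2 y = Rep_su2 y ** (\<Sum>B\<in>su2_basis. ad_coeff A B y *\<^sub>R B)"
proof -
  obtain a b c d where y: "Rep_su2 y $ 1 $ 1 = Complex a b" "Rep_su2 y $ 1 $ 2 = Complex c d"
    by (metis complex.exhaust)
  define N where "N = (\<Sum>B\<in>su2_basis. ad_coeff A B y *\<^sub>R B)"
  have *: "conj_transpose (Rep_su2 y) ** A ** Rep_su2 y = N"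
    if "A = su2_X \<or> A = su2_Y \<or> A = su2_Z"
    using that unfolding N_def sum_su2_basis conj_transpose_def
    by (elim disjE; simp_all only: ad_coeff_values(1-9)[OF y])
      (simp_all add: Rep_su2_entries(1,2) y
       su2_X_def su2_Y_def su2_Z_def matrix_matrix_mult_def transpose_def sum_2
       vec_eq_iff forall_2 complex_eq_iff power2_eq_square algebra_simps)
  have "conj_transpose (Rep_su2 y) ** A ** Rep_su2 y = N"
    using * assms by (auto simp: su2_basis_def)
  moreover have "Rep_su2 y ** conj_transpose (Rep_su2 y) = mat 1"
    using Rep_su2[of y] by (simp add: SU2_def)
  ultimately have "Rep_su2 y ** N = A ** Rep_su2 y"
    by (metis matrix_mul_assoc matrix_mul_lid)
  then show ?thesis by (simp add: N_def)
qed

text \<open>The adjoint representation is orthogonal; this is what makes the Casimir operator bi-invariant.\<close>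

lemma ad_coeff_orthogonal:
  assumes "B \<in> su2_basis" "C \<in> su2_basis"
  shows "(\<Sum>A\<in>su2_basis. ad_coeff A B y * ad_coeff A C y) = (if B = C then 1 else 0)"
proof -
  obtain a b c d where y: "Rep_su2 y $ 1 $ 1 = Complex a b" "Rep_su2 y $ 1 $ 2 = Complex c d"
    by (metis complex.exhaust)
  note v = ad_coeff_values[OF y]
  have "(\<Sum>A\<in>su2_basis. ad_coeff A B y * ad_coeff A C y)
      = (if B = C then (a\<^sup>2 + b\<^sup>2 + c\<^sup>2 + d\<^sup>2)\<^sup>2 else 0)"
    using assms su2_basis_distinct unfolding sum_su2_basis su2_basis_def
    by (elim insertE emptyE) (simp_all add: v(1-9) power2_eq_square algebra_simps)
  then show ?thesis using v(10) by simp
qed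

section \<open>Calculus with functions of class \<open>C\<^sup>k\<close>\<close>

lemma Ck_on_cong:
  assumes "open U" "\<And>p. p \<in> U \<Longrightarrow> F p = G p"
  shows "Ck_on k U F \<longleftrightarrow> Ck_on k U G"
  using assms(2)
proof (induction k arbitrary: F G)
  case 0
  then show ?case by (simp cong: continuous_on_cong)
next
  case (Suc k)
  have d: "F differentiable_on U \<longleftrightarrow> G differentiable_on U"
    unfolding differentiable_on_def differentiable_def
    using Suc.prems by (metis has_derivative_transform)
  have "frechet_derivative F (at p) = frechet_derivative G (at p)"
    if "F differentiable_on U" "p \<in> U" for p
    using that Suc.prems assms(1)
    by (intro frechet_derivative_transform_within_open)
      (auto simp: differentiable_on_eq_differentiable_at)
  then have eq: "Ck_on k U (\<lambda>p. frechet_derivative F (at p) b) \<longleftrightarrow> Ck_on k U (\<lambda>p. frechet_derivative G (at p) b)"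
    if "F differentiable_on U" for b
    using that by (intro Suc.IH) simp
  show ?case using d eq by auto
qed

lemma Ck_on_subset:
  assumes "Ck_on k U F" "V \<subseteq> U" shows "Ck_on k V F"
  using assms
  by (induction k arbitrary: F) (auto intro: continuous_on_subset differentiable_on_subset)

lemma Ck_on_SucD: "Ck_on (Suc k) U F \<Longrightarrow> Ck_on k U F"
  by (induction k arbitrary: F) (auto intro: differentiable_imp_continuous_on)

lemma differentiable_on_open_has_derivative:
  assumes "open U" "F differentiable_on U" "p \<in> U"
  shows "(F has_derivative frechet_derivative F (at p)) (at p)"
  using assms differentiable_on_eq_differentiable_at frechet_derivative_works by blast

lemma frechet_derivative_eqI:
  "(F has_derivative F') (at p) \<Longrightarrow> frechet_derivative F (at p) = F'"
  using frechet_derivative_at by metis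

text \<open>The derivative may be given by any formula on \<open>U\<close>; this spares the computation of
\<open>frechet_derivative\<close> in the closure properties below.\<close>

lemma Ck_on_SucI:
  assumes U: "open U" and F: "\<And>p. p \<in> U \<Longrightarrow> (F has_derivative F' p) (at p)"
    and C: "\<And>b. b \<in> Basis \<Longrightarrow> Ck_on k U (\<lambda>p. F' p b)"
  shows "Ck_on (Suc k) U F"
proof -
  have "F differentiable_on U"
    using F U by (auto simp: differentiable_on_eq_differentiable_at differentiable_def)
  moreover have "Ck_on k U (\<lambda>p. frechet_derivative F (at p) b)" if "b \<in> Basis" for b
  proof -
    have "F' p b = frechet_derivative F (at p) b" if "p \<in> U" for p
      by (simp add: frechet_derivative_eqI[OF F[OF that]])
    then show ?thesis by (rule iffD1[OF Ck_on_cong[OF U] C[OF that]])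
  qed
  ultimately show ?thesis by simp
qed

lemma Ck_on_const: 
  assumes "open U"
  shows "Ck_on k U (\<lambda>p. c)"
  by (induction k arbitrary: c) auto

lemma Ck_on_add:
  assumes U: "open U"
  shows "Ck_on k U F \<Longrightarrow> Ck_on k U G \<Longrightarrow> Ck_on k U (\<lambda>p. F p + G p)"
proof (induction k arbitrary: F G)
  case 0 then show ?case by (auto intro: continuous_intros)
next
  case (Suc k)
  show ?case
    using Suc
    by (intro Ck_on_SucI[OF U, where F' = "\<lambda>p b. frechet_derivative F (at p) b + frechet_derivative G (at p) b"])
      (auto intro!: has_derivative_add differentiable_on_open_has_derivative[OF U])
qed

lemma Ck_on_cmult:
  assumes U: "open U"
  shows "Ck_on k U F \<Longrightarrow> Ck_on k U (\<lambda>p. c * F p)"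
proof (induction k arbitrary: F)
  case 0 then show ?case by (auto intro: continuous_intros)
next
  case (Suc k)
  then show ?case
    by (intro Ck_on_SucI[OF U, where F' = "\<lambda>p b. c * frechet_derivative F (at p) b"])
      (auto intro!: has_derivative_mult_right differentiable_on_open_has_derivative[OF U])
qed

text \<open>On the matrix space, a left-invariant field is a derivation whose coefficients are linear in the
matrix entries.\<close>

lemma Ck_on_linear_mult:
  assumes U: "open U" and l: "bounded_linear l"
  shows "Ck_on k U F \<Longrightarrow> Ck_on k U (\<lambda>p. l p * F p)"
proof (induction k arbitrary: F)
  case 0 then show ?case using linear_continuous_on[OF l] by (auto intro: continuous_intros)
next
  case (Suc k)
  show ?case
  proof (intro Ck_on_SucI[OF U, where F' = "\<lambda>p b. l p * frechet_derivative F (at p) b + l b * F p"])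
    show "((\<lambda>p. l p * F p) has_derivative (\<lambda>b. l p * frechet_derivative F (at p) b + l b * F p)) (at p)"
      if "p \<in> U" for p
      using Suc.prems that
      by (intro has_derivative_mult bounded_linear_imp_has_derivative l
          differentiable_on_open_has_derivative[OF U]) auto
    show "Ck_on k U (\<lambda>p. l p * frechet_derivative F (at p) b + l b * F p)" if "b \<in> Basis" for b
      using Suc that by (intro Ck_on_add U Ck_on_cmult Ck_on_SucD[OF Suc.prems]) auto
  qed
qed

lemma Ck_on_sum:
  assumes U: "open U" and "finite I" "\<And>i. i \<in> I \<Longrightarrow> Ck_on k U (F i)"
  shows "Ck_on k U (\<lambda>p. \<Sum>i\<in>I. F i p)"
  using assms(2,3) by (induction I rule: finite_induct) (auto intro: Ck_on_const Ck_on_add U)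

lemma has_derivative_euclidean_expansion:
  fixes F :: "'a::euclidean_space \<Rightarrow> real"
  assumes "(F has_derivative F') (at p)"
  shows "F' v = (\<Sum>b\<in>Basis. (v \<bullet> b) * F' b)"
proof -
  have "linear F'" using assms has_derivative_linear by blast
  then have "F' (\<Sum>b\<in>Basis. (v \<bullet> b) *\<^sub>R b) = (\<Sum>b\<in>Basis. (v \<bullet> b) *\<^sub>R F' b)"
    by (simp add: linear_sum linear_scale)
  then show ?thesis by (simp add: euclidean_representation)
qed

lemma Ck_on_linear_compose:
  fixes T :: "'a::euclidean_space \<Rightarrow> 'a"
  assumes V: "open V" and T: "bounded_linear T" "T ` U \<subseteq> V" and U: "open U"
  shows "Ck_on k V F \<Longrightarrow> Ck_on k U (\<lambda>p. F (T p))"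
proof (induction k arbitrary: F)
  case 0 then show ?case
    using linear_continuous_on[OF T(1)] T(2) by (auto intro: continuous_on_compose2)
next
  case (Suc k)
  have F: "(F has_derivative frechet_derivative F (at q)) (at q)" if "q \<in> V" for q
    using Suc.prems that by (intro differentiable_on_open_has_derivative[OF V]) auto
  show ?case
  proof (intro Ck_on_SucI[OF U, where F' = "\<lambda>p b. frechet_derivative F (at (T p)) (T b)"])
    show "((\<lambda>p. F (T p)) has_derivative (\<lambda>b. frechet_derivative F (at (T p)) (T b))) (at p)"
      if "p \<in> U" for p
      using that T(2) by (intro has_derivative_compose[OF bounded_linear_imp_has_derivative[OF T(1)]] F) auto
    fix b :: 'a assume "b \<in> Basis"
    have "Ck_on k U (\<lambda>p. \<Sum>c\<in>Basis. (T b \<bullet> c) * frechet_derivative F (at (T p)) c)"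
      using Suc by (intro Ck_on_sum Ck_on_cmult U) auto
    moreover have "(\<Sum>c\<in>Basis. (T b \<bullet> c) * frechet_derivative F (at (T p)) c)
        = frechet_derivative F (at (T p)) (T b)" if "p \<in> U" for p
      using has_derivative_euclidean_expansion[OF F, of "T p" "T b"] that T(2) by auto
    ultimately show "Ck_on k U (\<lambda>p. frechet_derivative F (at (T p)) (T b))"
      by (rule iffD1[OF Ck_on_cong[OF U], rotated])
  qed
qed

section \<open>Smooth functions on SU(2) and left-invariant fields\<close>

text \<open>Local extensions to the matrix space reduce differentiation on the group to ordinary calculus.\<close>

lemma smooth_su2E:
  assumes "smooth_su2 g"
  obtains U F where "open U" "Rep_su2 x \<in> U" "\<And>k. Ck_on k U F"
    "\<And>y. Rep_su2 y \<in> U \<Longrightarrow> F (Rep_su2 y) = g y"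
    "\<And>p. p \<in> U \<Longrightarrow> (F has_derivative frechet_derivative F (at p)) (at p)"
proof -
  obtain U F where UF: "open U" "Rep_su2 x \<in> U" "\<And>k. Ck_on k U F"
    "\<And>y. Rep_su2 y \<in> U \<Longrightarrow> F (Rep_su2 y) = g y"
    using assms unfolding smooth_su2_def by metis
  moreover have "(F has_derivative frechet_derivative F (at p)) (at p)" if "p \<in> U" for p
    using UF(1) that UF(3)[of "Suc 0"] by (intro differentiable_on_open_has_derivative) auto
  ultimately show thesis using that by blast
qed

lemma has_real_derivative_along_curve:
  assumes U: "open U" "Rep_su2 (c s) \<in> U" and F: "\<And>y. Rep_su2 y \<in> U \<Longrightarrow> F (Rep_su2 y) = g y"
    and F': "(F has_derivative F') (at (Rep_su2 (c s)))"
    and c: "((\<lambda>s. Rep_su2 (c s)) has_vector_derivative v) (at s)"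
  shows "((\<lambda>s. g (c s)) has_real_derivative F' v) (at s)"
proof -
  have "((\<lambda>s. F (Rep_su2 (c s))) has_vector_derivative F' v) (at s)"
    using vector_derivative_diff_chain_within[of "\<lambda>s. Rep_su2 (c s)" v s UNIV F F'] c
      has_derivative_at_withinI[OF F'] by (simp add: o_def)
  then have F'': "((\<lambda>s. F (Rep_su2 (c s))) has_real_derivative F' v) (at s)"
    by (simp add: has_real_derivative_iff_has_vector_derivative)
  have "isCont (\<lambda>s. Rep_su2 (c s)) s" using c by (rule has_vector_derivative_continuous)
  then have "\<forall>\<^sub>F r in nhds s. Rep_su2 (c r) \<in> U"
    using U by (simp add: continuous_at_open eventually_nhds)
  then have "\<forall>\<^sub>F r in nhds s. F (Rep_su2 (c r)) = g (c r)"
    by (rule eventually_mono[OF _ F])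
  then show ?thesis using F'' by (subst (asm) DERIV_cong_ev[OF refl _ refl])
qed

lemma left_inv_field_deriv: "left_inv_field A g x = deriv (\<lambda>s. g (x * su2_exp A s)) 0"
  by (simp add: left_inv_field_def su2_exp_def)

text \<open>The left-invariant field \<open>A\<close> at \<open>y\<close> is the tangent vector \<open>y A\<close>, whatever extension is used.\<close>

lemma left_inv_field_frechet:
  assumes A: "A \<in> su2_basis" and U: "open U" "Rep_su2 y \<in> U"
    and F: "\<And>y. Rep_su2 y \<in> U \<Longrightarrow> F (Rep_su2 y) = g y"
    and F': "(F has_derivative F') (at (Rep_su2 y))"
  shows "left_inv_field A g y = F' (Rep_su2 y ** A)"
proof -
  have "((\<lambda>s. Rep_su2 (y * su2_exp A s)) has_vector_derivative Rep_su2 y ** A) (at 0)"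
    using Rep_su2_exp_has_vector_derivative[OF A, of y su2_one 0] A
    by (simp add: Rep_su2_one)
  then have "((\<lambda>s. g (y * su2_exp A s)) has_real_derivative F' (Rep_su2 y ** A)) (at 0)"
    using A U F F' by (intro has_real_derivative_along_curve[of U _ _ F]) simp_all
  then show ?thesis by (simp add: left_inv_field_deriv DERIV_imp_deriv)
qed

text \<open>Moving \<open>y\<close> to the left of the exponential turns the flow of \<open>A\<close> into the flow of \<open>y\<^sup>-\<^sup>1 A y\<close>, whence
the coefficients of the adjoint representation.\<close>

lemma smooth_su2_chain_rule:
  assumes g: "smooth_su2 g" and A: "A \<in> su2_basis"
  shows "((\<lambda>s. g (x * su2_exp A s * y)) has_real_derivative
    (\<Sum>B\<in>su2_basis. ad_coeff A B y * left_inv_field B g (x * su2_exp A s * y))) (at s)"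
proof -
  define z where "z = x * su2_exp A s * y"
  obtain U F where UF: "open U" "Rep_su2 z \<in> U"
    "\<And>y. Rep_su2 y \<in> U \<Longrightarrow> F (Rep_su2 y) = g y"
    "\<And>p. p \<in> U \<Longrightarrow> (F has_derivative frechet_derivative F (at p)) (at p)"
    using smooth_su2E[OF g, of z] by metis
  define F' where "F' = frechet_derivative F (at (Rep_su2 z))"
  have F': "(F has_derivative F') (at (Rep_su2 z))" using UF F'_def by simp
  then have lin: "linear F'" by (rule has_derivative_linear)
  have "Rep_su2 (x * su2_exp A s) ** A ** Rep_su2 y
      = Rep_su2 z ** (\<Sum>B\<in>su2_basis. ad_coeff A B y *\<^sub>R B)"
    by (simp add: z_def times_su2.rep_eq ad_coeff_expansion[OF A] flip: matrix_mul_assoc)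
  also have "\<dots> = (\<Sum>B\<in>su2_basis. ad_coeff A B y *\<^sub>R (Rep_su2 z ** B))"
    by (simp add: linear_sum[OF bounded_linear.linear[OF bounded_linear_matrix_mult_left]] matrix_mult_linear_simps)
  finally have v: "Rep_su2 (x * su2_exp A s) ** A ** Rep_su2 y
      = (\<Sum>B\<in>su2_basis. ad_coeff A B y *\<^sub>R (Rep_su2 z ** B))" .
  have "((\<lambda>s. g (x * su2_exp A s * y)) has_real_derivative
      F' (Rep_su2 (x * su2_exp A s) ** A ** Rep_su2 y)) (at s)"
    using UF F' A unfolding z_def
    by (intro has_real_derivative_along_curve[of U _ _ F] Rep_su2_exp_has_vector_derivative) auto
  moreover have "F' (Rep_su2 (x * su2_exp A s) ** A ** Rep_su2 y)
      = (\<Sum>B\<in>su2_basis. ad_coeff A B y * left_inv_field B g z)"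
    unfolding v using left_inv_field_frechet[OF _ UF(1,2,3) F']
    by (simp add: linear_sum[OF lin] linear_scale[OF lin])
  ultimately show ?thesis by (simp add: z_def)
qed

lemma ad_coeff_one:
  assumes "A \<in> su2_basis" "B \<in> su2_basis"
  shows "ad_coeff A B su2_one = (if A = B then 1 else 0)"
proof -
  have "Rep_su2 su2_one $ 1 $ 1 = Complex 1 0" "Rep_su2 su2_one $ 1 $ 2 = Complex 0 0"
    by (simp_all add: Rep_su2_one mat_def complex_eq_iff)
  from ad_coeff_values[OF this] show ?thesis
    using assms su2_basis_distinct unfolding su2_basis_def by auto
qed

lemma sum_ad_coeff_one:
  assumes "A \<in> su2_basis"
  shows "(\<Sum>B\<in>su2_basis. ad_coeff A B su2_one * g B) = g A"
proof -
  have "(\<Sum>B\<in>su2_basis. ad_coeff A B su2_one * g B) = (\<Sum>B\<in>su2_basis. if B = A then g B else 0)"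
    using assms by (intro sum.cong) (auto simp: ad_coeff_one)
  then show ?thesis using assms by (simp add: sum.delta)
qed

lemma smooth_su2_has_field_derivative:
  assumes g: "smooth_su2 g" and A: "A \<in> su2_basis"
  shows "((\<lambda>s. g (x * su2_exp A s)) has_real_derivative left_inv_field A g (x * su2_exp A s)) (at s)"
  using smooth_su2_chain_rule[OF g A, of x su2_one s] sum_ad_coeff_one[OF A] by simp

lemma left_inv_fieldI:
  assumes "A \<in> su2_basis" "((\<lambda>s. g (x * su2_exp A s)) has_real_derivative d) (at 0)"
  shows "left_inv_field A g x = d"
  using assms by (simp add: left_inv_field_deriv DERIV_imp_deriv)

lemma smooth_su2_continuous:
  assumes "smooth_su2 g" shows "continuous_on UNIV g"
proof -
  have "isCont g x" for x
  proof -
    obtain U F where UF: "open U" "Rep_su2 x \<in> U" "\<And>k. Ck_on k U F"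
      "\<And>y. Rep_su2 y \<in> U \<Longrightarrow> F (Rep_su2 y) = g y"
      using smooth_su2E[OF assms, of x] by metis
    have V: "open (Rep_su2 -` U)"
      using continuous_on_Rep_su2 UF(1) by (rule open_vimage[rotated])
    have "continuous_on (Rep_su2 -` U) (\<lambda>y. F (Rep_su2 y))"
      using UF(3)[of 0] by (intro continuous_on_compose2[OF _ continuous_on_Rep_su2]) auto
    then have "continuous_on (Rep_su2 -` U) g"
      by (rule continuous_on_cong[THEN iffD1, rotated 2]) (auto simp: UF(4))
    then show ?thesis using V UF(2) by (simp add: continuous_on_eq_continuous_at)
  qed
  then show ?thesis by (simp add: continuous_on_eq_continuous_at)
qed

lemma smooth_su2_add:
  assumes "smooth_su2 g" "smooth_su2 h"
  shows "smooth_su2 (\<lambda>x. g x + h x)"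
  unfolding smooth_su2_def
proof
  fix x
  obtain U F where UF: "open U" "Rep_su2 x \<in> U" "\<And>k. Ck_on k U F"
    "\<And>y. Rep_su2 y \<in> U \<Longrightarrow> F (Rep_su2 y) = g y"
    using smooth_su2E[OF assms(1), of x] by metis
  obtain V G where VG: "open V" "Rep_su2 x \<in> V" "\<And>k. Ck_on k V G"
    "\<And>y. Rep_su2 y \<in> V \<Longrightarrow> G (Rep_su2 y) = h y"
    using smooth_su2E[OF assms(2), of x] by metis
  show "\<exists>U F. open U \<and> Rep_su2 x \<in> U \<and> (\<forall>k. Ck_on k U F) \<and>
      (\<forall>y. Rep_su2 y \<in> U \<longrightarrow> F (Rep_su2 y) = g y + h y)"
    using UF VG
    by (intro exI[of _ "U \<inter> V"] exI[of _ "\<lambda>p. F p + G p"])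
      (auto intro!: Ck_on_add intro: Ck_on_subset)
qed

lemma smooth_su2_compose_linear:
  assumes g: "smooth_su2 g" and T: "bounded_linear T" and \<phi>: "\<And>x. Rep_su2 (\<phi> x) = T (Rep_su2 x)"
  shows "smooth_su2 (\<lambda>x. g (\<phi> x))"
  unfolding smooth_su2_def
proof
  fix x
  obtain U F where UF: "open U" "Rep_su2 (\<phi> x) \<in> U" "\<And>k. Ck_on k U F"
    "\<And>y. Rep_su2 y \<in> U \<Longrightarrow> F (Rep_su2 y) = g y"
    using smooth_su2E[OF g, of "\<phi> x"] by metis
  have V: "open (T -` U)"
    using linear_continuous_on[OF T] UF(1) by (rule open_vimage[rotated])
  show "\<exists>U F. open U \<and> Rep_su2 x \<in> U \<and> (\<forall>k. Ck_on k U F) \<and>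
      (\<forall>y. Rep_su2 y \<in> U \<longrightarrow> F (Rep_su2 y) = g (\<phi> y))"
  proof (intro exI conjI allI impI)
    show "Ck_on k (T -` U) (\<lambda>p. F (T p))" for k
      by (rule Ck_on_linear_compose[OF UF(1) T _ V UF(3)]) auto
    show "F (T (Rep_su2 y)) = g (\<phi> y)" if "Rep_su2 y \<in> T -` U" for y
      using that UF(4)[of "\<phi> y"] by (simp add: \<phi>)
  qed (use V UF(2) \<phi> in auto)
qed

lemma smooth_su2_left_translate: "smooth_su2 g \<Longrightarrow> smooth_su2 (\<lambda>x. g (k * x))"
  by (rule smooth_su2_compose_linear[where \<phi> = "\<lambda>x. k * x", OF _ bounded_linear_matrix_mult_left[of "Rep_su2 k"]])
    (simp_all add: times_su2.rep_eq)

lemma smooth_su2_right_translate: "smooth_su2 g \<Longrightarrow> smooth_su2 (\<lambda>x. g (x * k))"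
  by (rule smooth_su2_compose_linear[where \<phi> = "\<lambda>x. x * k", OF _ bounded_linear_matrix_mult_right[of "Rep_su2 k"]])
    (simp_all add: times_su2.rep_eq)

text \<open>An extension of the derivative is \<open>p \<mapsto> DF(p)(p A)\<close>, a combination of partial derivatives of \<open>F\<close>
with linear coefficients.\<close>

lemma smooth_su2_left_inv_field:
  assumes g: "smooth_su2 g" and A: "A \<in> su2_basis"
  shows "smooth_su2 (left_inv_field A g)"
  unfolding smooth_su2_def
proof
  fix x
  obtain U F where UF: "open U" "Rep_su2 x \<in> U" "\<And>k. Ck_on k U F"
    "\<And>y. Rep_su2 y \<in> U \<Longrightarrow> F (Rep_su2 y) = g y"
    "\<And>p. p \<in> U \<Longrightarrow> (F has_derivative frechet_derivative F (at p)) (at p)"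
    using smooth_su2E[OF g, of x] by metis
  define G where "G p = (\<Sum>b\<in>Basis. ((p ** A) \<bullet> b) * frechet_derivative F (at p) b)" for p
  have "Ck_on k U G" for k
    unfolding G_def
  proof (intro Ck_on_sum UF(1) Ck_on_linear_mult)
    show "bounded_linear (\<lambda>p :: complex^2^2. (p ** A) \<bullet> b)" for b
      using bounded_linear_compose[OF bounded_linear_inner_left[of b] bounded_linear_matrix_mult_right[of A]]
      by simp
    show "Ck_on k U (\<lambda>p. frechet_derivative F (at p) b)" if "b \<in> Basis" for b
      using UF(3)[of "Suc k"] that by simp
  qed simp
  moreover have "G (Rep_su2 y) = left_inv_field A g y" if "Rep_su2 y \<in> U" for y
  proof -
    have "left_inv_field A g y = frechet_derivative F (at (Rep_su2 y)) (Rep_su2 y ** A)"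
      by (rule left_inv_field_frechet[OF A UF(1) that _ UF(5)[OF that]]) (rule UF(4))
    then show ?thesis
      unfolding G_def by (simp only: has_derivative_euclidean_expansion[OF UF(5)[OF that], symmetric])
  qed
  ultimately show "\<exists>U F. open U \<and> Rep_su2 x \<in> U \<and> (\<forall>k. Ck_on k U F) \<and>
      (\<forall>y. Rep_su2 y \<in> U \<longrightarrow> F (Rep_su2 y) = left_inv_field A g y)"
    using UF(1,2) by blast
qed

lemma left_inv_field_sum_cmult:
  assumes "\<And>i. i \<in> I \<Longrightarrow> smooth_su2 (g i)" "A \<in> su2_basis"
  shows "left_inv_field A (\<lambda>x. \<Sum>i\<in>I. c i * g i x) x = (\<Sum>i\<in>I. c i * left_inv_field A (g i) x)"
proof (rule left_inv_fieldI[OF assms(2)])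
  have "((\<lambda>s. g i (x * su2_exp A s)) has_real_derivative left_inv_field A (g i) x) (at 0)" if "i \<in> I" for i
    using smooth_su2_has_field_derivative[OF assms(1)[OF that] assms(2), of x 0] assms(2) by simp
  then show "((\<lambda>s. \<Sum>i\<in>I. c i * g i (x * su2_exp A s)) has_real_derivative
      (\<Sum>i\<in>I. c i * left_inv_field A (g i) x)) (at 0)"
    by (intro DERIV_sum DERIV_cmult)
qed

lemma left_inv_field_left_translate:
  "left_inv_field A (\<lambda>z. g (k * z)) = (\<lambda>x. left_inv_field A g (k * x))"
  by (rule ext) (simp add: left_inv_field_deriv su2_mult_assoc)

lemma left_inv_field_right_translate:
  assumes "smooth_su2 g" "A \<in> su2_basis"
  shows "left_inv_field A (\<lambda>z. g (z * y))
    = (\<lambda>x. \<Sum>B\<in>su2_basis. ad_coeff A B y * left_inv_field B g (x * y))"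
proof
  fix x show "left_inv_field A (\<lambda>z. g (z * y)) x
    = (\<Sum>B\<in>su2_basis. ad_coeff A B y * left_inv_field B g (x * y))"
    using smooth_su2_chain_rule[OF assms, of x y 0] assms(2)
    by (intro left_inv_fieldI) simp_all
qed

text \<open>A form of the symmetry of mixed partial derivatives that assumes existence of one of them only and
yields the other one. It follows by writing \<open>\<phi> t s = \<phi> a s + \<integral> \<psi> r s dr\<close> and differentiating under
the integral.\<close>

lemma has_real_derivative_mixed_partial:
  fixes \<phi> \<psi> \<psi>s :: "real \<Rightarrow> real \<Rightarrow> real"
  assumes t0: "a < t0" "t0 < b"
    and \<phi>t: "\<And>t s. t \<in> {a..b} \<Longrightarrow> ((\<lambda>t. \<phi> t s) has_real_derivative \<psi> t s) (at t)"
    and \<phi>s: "\<And>t. t \<in> {a..b} \<Longrightarrow> (\<phi> t has_real_derivative \<phi>s t) (at 0)"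
    and \<psi>s: "\<And>t s. t \<in> {a..b} \<Longrightarrow> (\<psi> t has_real_derivative \<psi>s t s) (at s)"
    and cont: "continuous_on ({a..b} \<times> UNIV) (\<lambda>(t, s). \<psi>s t s)"
  shows "(\<phi>s has_real_derivative \<psi>s t0 0) (at t0)"
proof -
  have int: "((\<lambda>r. \<psi> r s) has_integral \<phi> t s - \<phi> a s) {a..t}" if "t \<in> {a..b}" for t s
    using that by (intro fundamental_theorem_of_calculus)
      (auto simp flip: has_real_derivative_iff_has_vector_derivative intro!: has_field_derivative_at_within[OF \<phi>t])
  have eq: "\<phi>s t = \<phi>s a + integral {a..t} (\<lambda>r. \<psi>s r 0)" if t: "t \<in> {a..b}" for t
  proof -
    have "continuous_on (UNIV \<times> cbox a t) (\<lambda>(s, r). \<psi>s r s)"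
      using t unfolding split_beta
      by (intro continuous_on_compose2[OF cont[unfolded split_beta], of _ "\<lambda>p. (snd p, fst p)", simplified])
        (auto intro!: continuous_intros)
    then have "((\<lambda>s. integral (cbox a t) (\<lambda>r. \<psi> r s)) has_field_derivative
        integral (cbox a t) (\<lambda>r. \<psi>s r 0)) (at 0 within UNIV)"
      using t int \<psi>s by (intro leibniz_rule_field_derivative) (auto intro: has_integral_integrable)
    then have "((\<lambda>s. \<phi> a s + integral {a..t} (\<lambda>r. \<psi> r s)) has_real_derivative
        \<phi>s a + integral {a..t} (\<lambda>r. \<psi>s r 0)) (at 0)"
      using t by (intro DERIV_add \<phi>s) auto
    moreover have "integral {a..t} (\<lambda>r. \<psi> r s) = \<phi> t s - \<phi> a s" for s
      using int[OF t] by (rule integral_unique)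
    ultimately have "(\<phi> t has_real_derivative \<phi>s a + integral {a..t} (\<lambda>r. \<psi>s r 0)) (at 0)"
      by simp
    then show ?thesis using \<phi>s[OF t] DERIV_unique by blast
  qed
  have "continuous_on {a..b} (\<lambda>r. \<psi>s r 0)"
    by (rule continuous_on_compose2[OF cont, of _ "\<lambda>r. (r, 0)", simplified]) (auto intro!: continuous_intros)
  then have "((\<lambda>t. integral {a..t} (\<lambda>r. \<psi>s r 0)) has_real_derivative \<psi>s t0 0) (at t0 within {a..b})"
    using t0 by (intro integral_has_real_derivative) auto
  from DERIV_add[OF DERIV_const[of "\<phi>s a"] this]
  have "((\<lambda>t. \<phi>s a + integral {a..t} (\<lambda>r. \<psi>s r 0)) has_real_derivative \<psi>s t0 0) (at t0 within {a..b})"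
    by simp
  then have "(\<phi>s has_real_derivative \<psi>s t0 0) (at t0 within {a..b})"
    by (rule has_field_derivative_transform_within[OF _ zero_less_one])
      (use t0 eq in \<open>simp_all del: atLeastAtMost_iff\<close>, auto)
  then show ?thesis using t0 by (simp add: at_within_Icc_at)
qed

section \<open>Commutators and differentiation of kernels\<close>

text \<open>Commutators are read off from \<open>g (x exp(sA) exp(tB))\<close>: the two orders of differentiation at the
origin give \<open>A (B g)\<close> on the one hand and \<open>B (A g)\<close> plus the derivative of the adjoint coefficients,
that is the Lie bracket, on the other.\<close>

lemma left_inv_field_commutator:
  assumes g: "smooth_su2 g" and A: "A \<in> su2_basis" and B: "B \<in> su2_basis"
    and c: "\<And>C. C \<in> su2_basis \<Longrightarrow> ((\<lambda>t. ad_coeff A C (su2_exp B t)) has_real_derivative c C) (at 0)"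
  shows "left_inv_field A (left_inv_field B g) x - left_inv_field B (left_inv_field A g) x
    = (\<Sum>C\<in>su2_basis. c C * left_inv_field C g x)"
proof -
  define \<phi>s where "\<phi>s t = (\<Sum>C\<in>su2_basis. ad_coeff A C (su2_exp B t) * left_inv_field C g (x * su2_exp B t))" for t
  define \<psi>s where "\<psi>s t s = (\<Sum>C\<in>su2_basis. ad_coeff A C (su2_exp B t) *
    left_inv_field C (left_inv_field B g) (x * su2_exp A s * su2_exp B t))" for t s
  have sB: "smooth_su2 (left_inv_field C g)" if "C \<in> su2_basis" for C
    using smooth_su2_left_inv_field[OF g that] .
  have sBB: "smooth_su2 (left_inv_field C (left_inv_field B g))" if "C \<in> su2_basis" for C
    using smooth_su2_left_inv_field[OF sB[OF B] that] .
  have "(\<phi>s has_real_derivative \<psi>s 0 0) (at 0)"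
  proof (rule has_real_derivative_mixed_partial[where a = "-1" and b = 1 and ?t0.0 = 0 and \<psi>s = \<psi>s
      and \<phi> = "\<lambda>t s. g (x * su2_exp A s * su2_exp B t)"
      and \<psi> = "\<lambda>t s. left_inv_field B g (x * su2_exp A s * su2_exp B t)"])
    show "((\<lambda>t. g (x * su2_exp A s * su2_exp B t)) has_real_derivative
        left_inv_field B g (x * su2_exp A s * su2_exp B t)) (at t)" for t s
      by (rule smooth_su2_has_field_derivative[OF g B])
    show "((\<lambda>s. g (x * su2_exp A s * su2_exp B t)) has_real_derivative \<phi>s t) (at 0)" for t
      using smooth_su2_chain_rule[OF g A, of x "su2_exp B t" 0] A by (simp add: \<phi>s_def)
    show "((\<lambda>s. left_inv_field B g (x * su2_exp A s * su2_exp B t)) has_real_derivative \<psi>s t s) (at s)" for t s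
      unfolding \<psi>s_def by (rule smooth_su2_chain_rule[OF sB[OF B] A])
    have "continuous_on UNIV (\<lambda>(t, s). \<psi>s t s)"
      unfolding \<psi>s_def split_beta
      by (intro continuous_intros continuous_on_compose2[OF smooth_su2_continuous[OF sBB]])
        (use A B in auto)
    then show "continuous_on ({-1..1} \<times> UNIV) (\<lambda>(t, s). \<psi>s t s)"
      by (rule continuous_on_subset) auto
  qed auto
  moreover have "(\<phi>s has_real_derivative (\<Sum>C\<in>su2_basis. c C * left_inv_field C g x +
      left_inv_field B (left_inv_field C g) x * ad_coeff A C su2_one)) (at 0)"
    unfolding \<phi>s_def
  proof (intro DERIV_sum)
    fix C assume C: "C \<in> su2_basis"
    show "((\<lambda>t. ad_coeff A C (su2_exp B t) * left_inv_field C g (x * su2_exp B t)) has_real_derivative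
      c C * left_inv_field C g x + left_inv_field B (left_inv_field C g) x * ad_coeff A C su2_one) (at 0)"
      using DERIV_mult[OF c[OF C] smooth_su2_has_field_derivative[OF sB[OF C] B, of x 0]] B by simp
  qed
  ultimately have "\<psi>s 0 0 = (\<Sum>C\<in>su2_basis. c C * left_inv_field C g x +
      left_inv_field B (left_inv_field C g) x * ad_coeff A C su2_one)"
    by (rule DERIV_unique)
  then show ?thesis
    using A B sum_ad_coeff_one[OF A, of "\<lambda>C. left_inv_field B (left_inv_field C g) x"]
      sum_ad_coeff_one[OF A, of "\<lambda>C. left_inv_field C (left_inv_field B g) x"]
    by (simp add: \<psi>s_def sum.distrib mult.commute)
qed

lemma su2_commutators:
  assumes g: "smooth_su2 g"
  shows "left_inv_field su2_X (left_inv_field su2_Y g) x - left_inv_field su2_Y (left_inv_field su2_X g) x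
      = 2 * left_inv_field su2_Z g x" (is ?XY)
    and "left_inv_field su2_Y (left_inv_field su2_Z g) x - left_inv_field su2_Z (left_inv_field su2_Y g) x
      = 2 * left_inv_field su2_X g x" (is ?YZ)
    and "left_inv_field su2_Z (left_inv_field su2_X g) x - left_inv_field su2_X (left_inv_field su2_Z g) x
      = 2 * left_inv_field su2_Y g x" (is ?ZX)
proof -
  have X: "Rep_su2 (su2_exp su2_X t) $ 1 $ 1 = Complex (cos t) 0"
    "Rep_su2 (su2_exp su2_X t) $ 1 $ 2 = Complex (sin t) 0" for t
    unfolding Rep_su2_exp[OF su2_basis_mem(1)] by (simp_all add: su2_X_def mat_def complex_eq_iff)
  have Y: "Rep_su2 (su2_exp su2_Y t) $ 1 $ 1 = Complex (cos t) 0"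
    "Rep_su2 (su2_exp su2_Y t) $ 1 $ 2 = Complex 0 (sin t)" for t
    unfolding Rep_su2_exp[OF su2_basis_mem(2)] by (simp_all add: su2_Y_def mat_def complex_eq_iff)
  have Z: "Rep_su2 (su2_exp su2_Z t) $ 1 $ 1 = Complex (cos t) (sin t)"
    "Rep_su2 (su2_exp su2_Z t) $ 1 $ 2 = Complex 0 0" for t
    unfolding Rep_su2_exp[OF su2_basis_mem(3)] by (simp_all add: su2_Z_def mat_def complex_eq_iff)
  have *: "((\<lambda>t. ad_coeff A C (su2_exp B t)) has_real_derivative (if C = D then 2 else 0)) (at 0)"
    if "(A, B, D) \<in> {(su2_X, su2_Y, su2_Z), (su2_Y, su2_Z, su2_X), (su2_Z, su2_X, su2_Y)}" "C \<in> su2_basis"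
    for A B C D
    using that su2_basis_distinct unfolding su2_basis_def
    by (elim insertE emptyE; simp add: ad_coeff_values[OF X] ad_coeff_values[OF Y] ad_coeff_values[OF Z])
      (auto intro!: derivative_eq_intros)
  show ?XY ?YZ ?ZX
    using left_inv_field_commutator[OF g _ _ *[where D = su2_Z], where A = su2_X and B = su2_Y]
      left_inv_field_commutator[OF g _ _ *[where D = su2_X], where A = su2_Y and B = su2_Z]
      left_inv_field_commutator[OF g _ _ *[where D = su2_Y], where A = su2_Z and B = su2_X]
    by (simp_all add: if_distrib[of "\<lambda>c. c * _"] sum.delta cong: if_cong)
qed

lemma smooth_su2_foldr_field:
  assumes "smooth_su2 g" "set W \<subseteq> su2_basis"
  shows "smooth_su2 (foldr left_inv_field W g)"
  using assms(2) by (induction W) (auto intro: assms(1) smooth_su2_left_inv_field)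

lemma foldr_field_sum_cmult:
  assumes "\<And>i. i \<in> I \<Longrightarrow> smooth_su2 (g i)" "set W \<subseteq> su2_basis"
  shows "foldr left_inv_field W (\<lambda>x. \<Sum>i\<in>I. c i * g i x) = (\<lambda>x. \<Sum>i\<in>I. c i * foldr left_inv_field W (g i) x)"
  using assms(2)
proof (induction W)
  case (Cons A W)
  then show ?case
    by (intro ext) (simp add: left_inv_field_sum_cmult smooth_su2_foldr_field assms(1))
qed simp

text \<open>Joint continuity in \<open>x\<close> and \<open>y\<close> of the iterated derivatives of \<open>z \<mapsto> f (z y)\<close>. The innermost field is
transported past \<open>y\<close> by the chain rule, hence the induction from the end of the word.\<close>

lemma continuous_on_foldr_field_right_translate:
  assumes "smooth_su2 g" "set W \<subseteq> su2_basis"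
  shows "continuous_on UNIV (\<lambda>(x, y). foldr left_inv_field W (\<lambda>z. g (z * y)) x)"
  using assms
proof (induction W arbitrary: g rule: rev_induct)
  case Nil
  then show ?case
    unfolding split_beta
    by (auto intro!: continuous_on_compose2[OF smooth_su2_continuous[OF Nil(1)]] continuous_intros)
next
  case (snoc A W)
  have sm: "smooth_su2 (left_inv_field B g)" if "B \<in> su2_basis" for B
    using smooth_su2_left_inv_field[OF snoc.prems(1) that] .
  have "foldr left_inv_field (W @ [A]) (\<lambda>z. g (z * y)) x
    = (\<Sum>B\<in>su2_basis. ad_coeff A B y * foldr left_inv_field W (\<lambda>z. left_inv_field B g (z * y)) x)" for x y
    using snoc.prems
    by (simp add: left_inv_field_right_translate foldr_field_sum_cmult smooth_su2_right_translate sm)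
  then show ?case
    using snoc.IH[OF sm] snoc.prems(2) unfolding split_beta
    by (auto intro!: continuous_intros)
qed

lemma bcontfun_su2:
  fixes f :: "su2 \<Rightarrow> real"
  assumes "continuous_on UNIV f"
  shows "apply_bcontfun (Bcontfun f) = f"
  using assms compact_imp_bounded[OF compact_continuous_image[OF assms compact_UNIV_su2]]
  by (intro Bcontfun_inverse) (simp add: bcontfun_def)

lemma Bcontfun_apply: "Bcontfun (apply_bcontfun f) = f"
  by (rule apply_bcontfun_inverse)

text \<open>By compactness of SU(2), joint continuity gives continuity with respect to the supremum norm.\<close>

lemma continuous_on_Bcontfun_su2:
  fixes k :: "'b::topological_space \<Rightarrow> su2 \<Rightarrow> real"
  assumes k: "continuous_on UNIV (\<lambda>(z, y). k z y)"
  shows "continuous_on UNIV (\<lambda>z. Bcontfun (k z))"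
proof -
  have kz: "continuous_on UNIV (k z)" for z
    by (rule continuous_on_compose2[OF k, of _ "Pair z", simplified]) (auto intro!: continuous_intros)
  have "((\<lambda>z. Bcontfun (k z)) \<longlongrightarrow> Bcontfun (k z0)) (at z0)" for z0
  proof (rule uniform_limit_tendsto_bcontfun, rule uniform_limitI)
    fix e :: real assume "e > 0"
    have "continuous_on (UNIV \<times> UNIV) (\<lambda>(z, y). k z y)" using k by simp
    then obtain X0 where "z0 \<in> X0" "open X0"
      "\<forall>z\<in>X0 \<inter> UNIV. \<forall>y\<in>UNIV. dist (case (z, y) of (z, y) \<Rightarrow> k z y) (case (z0, y) of (z, y) \<Rightarrow> k z y) \<le> e / 2"
      by (rule continuous_on_prod_compactE[OF _ compact_UNIV_su2, of UNIV _ z0 "e / 2"]) (use \<open>e > 0\<close> in auto)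
    then have "\<forall>\<^sub>F z in at z0. \<forall>y. dist (k z y) (k z0 y) \<le> e / 2"
      unfolding eventually_at_topological by auto
    then show "\<forall>\<^sub>F z in at z0. \<forall>y\<in>UNIV. dist (apply_bcontfun (Bcontfun (k z)) y) (apply_bcontfun (Bcontfun (k z0)) y) < e"
    proof eventually_elim
      case (elim z)
      have "dist (k z y) (k z0 y) < e" for y
        using elim[rule_format, of y] \<open>e > 0\<close> by linarith
      then show ?case by (simp add: bcontfun_su2 kz)
    qed
  qed
  then show ?thesis by (simp add: continuous_on_def)
qed

text \<open>By compactness, pointwise derivatives with jointly continuous derivative are derivatives in the
supremum norm; only then can they be taken under a continuous linear functional.\<close>

lemma Bcontfun_su2_has_vector_derivative:
  fixes k k' :: "real \<Rightarrow> su2 \<Rightarrow> real"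
  assumes k: "\<And>s. continuous_on UNIV (k s)" and k': "continuous_on UNIV (\<lambda>(s, y). k' s y)"
    and D: "\<And>s y. ((\<lambda>s. k s y) has_real_derivative k' s y) (at s)"
  shows "((\<lambda>s. Bcontfun (k s)) has_vector_derivative Bcontfun (k' s0)) (at s0)"
  unfolding has_vector_derivative_within_alt
proof (intro allI impI)
  fix e :: real assume e: "e > 0"
  have k's: "continuous_on UNIV (k' s)" for s
    by (rule continuous_on_compose2[OF k', of _ "Pair s", simplified]) (auto intro!: continuous_intros)
  have "isCont (\<lambda>s. Bcontfun (k' s)) s0"
    using continuous_on_Bcontfun_su2[OF k'] by (simp add: continuous_on_eq_continuous_at)
  then obtain \<delta> where \<delta>: "\<delta> > 0" "\<And>s. \<bar>s - s0\<bar> < \<delta> \<Longrightarrow> dist (Bcontfun (k' s)) (Bcontfun (k' s0)) < e"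
    using e unfolding continuous_at_eps_delta dist_real_def by blast
  have "norm (Bcontfun (k s) - Bcontfun (k s0) - (s - s0) *\<^sub>R Bcontfun (k' s0)) \<le> e * \<bar>s - s0\<bar>"
    if s: "\<bar>s - s0\<bar> < \<delta>" for s
  proof (rule norm_bound)
    fix y
    have "\<exists>r. \<bar>r - s0\<bar> < \<delta> \<and> k s y - k s0 y = (s - s0) * k' r y"
    proof (cases s s0 rule: linorder_cases)
      case less
      obtain r where "s < r" "r < s0" "k s0 y - k s y = (s0 - s) * k' r y"
        using MVT2[OF less, of "\<lambda>s. k s y" "\<lambda>s. k' s y"] D by blast
      then show ?thesis using s by (intro exI[of _ r]) (auto simp: algebra_simps)
    next
      case greater
      obtain r where "s0 < r" "r < s" "k s y - k s0 y = (s - s0) * k' r y"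
        using MVT2[OF greater, of "\<lambda>s. k s y" "\<lambda>s. k' s y"] D by blast
      then show ?thesis using s by (intro exI[of _ r]) (auto simp: algebra_simps)
    qed (use \<delta> in \<open>auto intro!: exI[of _ s0]\<close>)
    then obtain r where r: "\<bar>r - s0\<bar> < \<delta>" "k s y - k s0 y = (s - s0) * k' r y" by blast
    have "\<bar>k' r y - k' s0 y\<bar> \<le> dist (Bcontfun (k' r)) (Bcontfun (k' s0))"
      using dist_bounded[of "Bcontfun (k' r)" y "Bcontfun (k' s0)"] by (simp add: bcontfun_su2 k's dist_real_def)
    then have "\<bar>k' r y - k' s0 y\<bar> \<le> e" using \<delta>(2)[OF r(1)] by simp
    then have "\<bar>s - s0\<bar> * \<bar>k' r y - k' s0 y\<bar> \<le> e * \<bar>s - s0\<bar>"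
      using mult_right_mono[of _ e "\<bar>s - s0\<bar>"] by (simp add: mult.commute[of "\<bar>s - s0\<bar>"])
    moreover have "apply_bcontfun (Bcontfun (k s) - Bcontfun (k s0) - (s - s0) *\<^sub>R Bcontfun (k' s0)) y
        = (s - s0) * (k' r y - k' s0 y)"
      using r(2) by (simp add: bcontfun_su2 k k's algebra_simps)
    ultimately show "norm (apply_bcontfun (Bcontfun (k s) - Bcontfun (k s0) - (s - s0) *\<^sub>R Bcontfun (k' s0)) y)
        \<le> e * \<bar>s - s0\<bar>"
      by (simp add: abs_mult)
  qed
  then show "\<exists>\<delta>>0. \<forall>s\<in>UNIV. \<bar>s - s0\<bar> < \<delta> \<longrightarrow>
      norm (Bcontfun (k s) - Bcontfun (k s0) - (s - s0) *\<^sub>R Bcontfun (k' s0)) \<le> e * \<bar>s - s0\<bar>"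
    using \<delta>(1) by blast
qed

section \<open>Symmetries of the sub-Laplacian\<close>

lemma smooth_su2_subLaplacian:
  assumes "smooth_su2 g" shows "smooth_su2 (subLaplacian g)"
  unfolding subLaplacian_def[abs_def]
  using assms by (intro smooth_su2_add smooth_su2_left_inv_field) auto

lemma continuous_on_subLaplacian: "smooth_su2 g \<Longrightarrow> continuous_on UNIV (subLaplacian g)"
  by (intro smooth_su2_continuous smooth_su2_subLaplacian)

lemma subLaplacian_left_translate:
  "subLaplacian (\<lambda>z. g (k * z)) = (\<lambda>x. subLaplacian g (k * x))"
  by (rule ext) (simp add: subLaplacian_def left_inv_field_left_translate)

text \<open>The adjoint action of \<open>exp (s Z)\<close> is a rotation in the plane of \<open>X\<close> and \<open>Y\<close>, which leaves
\<open>X\<^sup>2 + Y\<^sup>2\<close> unchanged.\<close>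

lemma subLaplacian_right_translate_exp_Z:
  assumes g: "smooth_su2 g"
  shows "subLaplacian (\<lambda>z. g (z * su2_exp su2_Z s)) = (\<lambda>x. subLaplacian g (x * su2_exp su2_Z s))"
proof
  fix x
  define y where "y = su2_exp su2_Z s"
  have "Rep_su2 y $ 1 $ 1 = Complex (cos s) (sin s)" "Rep_su2 y $ 1 $ 2 = Complex 0 0"
    unfolding y_def Rep_su2_exp[OF su2_basis_mem(3)] by (simp_all add: su2_Z_def mat_def complex_eq_iff)
  note ad = ad_coeff_values[OF this]
  have sm: "smooth_su2 (left_inv_field B g)" if "B \<in> su2_basis" for B
    using smooth_su2_left_inv_field[OF g that] .
  have AA: "left_inv_field A (left_inv_field A (\<lambda>z. g (z * y))) x
      = (\<Sum>B\<in>su2_basis. ad_coeff A B y * (\<Sum>C\<in>su2_basis. ad_coeff A C y * left_inv_field C (left_inv_field B g) (x * y)))"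
    if A: "A \<in> su2_basis" for A
    by (simp add: left_inv_field_right_translate[OF g A] left_inv_field_right_translate[OF sm A]
        left_inv_field_sum_cmult A smooth_su2_right_translate sm)
  have cs: "cos s * cos s = 1 - sin s * sin s" by (simp add: cos_squared_eq flip: power2_eq_square)
  show "subLaplacian (\<lambda>z. g (z * su2_exp su2_Z s)) x = subLaplacian g (x * su2_exp su2_Z s)"
    unfolding subLaplacian_def y_def[symmetric] AA[OF su2_basis_mem(1)] AA[OF su2_basis_mem(2)] sum_su2_basis ad
    using cs by (simp add: power2_eq_square) algebra
qed

lemma subLaplacian_Casimir:
  "subLaplacian g x = (\<Sum>A\<in>su2_basis. left_inv_field A (left_inv_field A g) x)
    - left_inv_field su2_Z (left_inv_field su2_Z g) x"
  by (simp add: subLaplacian_def sum_su2_basis)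

text \<open>Moving \<open>y\<close> through both fields produces the double sum over the adjoint coefficients, which
collapses by orthogonality.\<close>

lemma Casimir_right_translate:
  assumes g: "smooth_su2 g"
  shows "(\<Sum>A\<in>su2_basis. left_inv_field A (left_inv_field A (\<lambda>z. g (z * y))) x)
    = (\<Sum>A\<in>su2_basis. left_inv_field A (left_inv_field A g) (x * y))"
proof -
  have sm: "smooth_su2 (left_inv_field B g)" if "B \<in> su2_basis" for B
    using smooth_su2_left_inv_field[OF g that] .
  have AA: "left_inv_field A (left_inv_field A (\<lambda>z. g (z * y))) x
      = (\<Sum>B\<in>su2_basis. \<Sum>C\<in>su2_basis. ad_coeff A B y * ad_coeff A C y * left_inv_field C (left_inv_field B g) (x * y))"
    if A: "A \<in> su2_basis" for A
    by (simp add: left_inv_field_right_translate[OF g A] left_inv_field_right_translate[OF sm A]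
        left_inv_field_sum_cmult A smooth_su2_right_translate sm sum_distrib_left mult.assoc)
  have "(\<Sum>A\<in>su2_basis. left_inv_field A (left_inv_field A (\<lambda>z. g (z * y))) x)
      = (\<Sum>A\<in>su2_basis. \<Sum>B\<in>su2_basis. \<Sum>C\<in>su2_basis. ad_coeff A B y * ad_coeff A C y * left_inv_field C (left_inv_field B g) (x * y))"
    by (intro sum.cong refl AA)
  also have "\<dots> = (\<Sum>B\<in>su2_basis. \<Sum>A\<in>su2_basis. \<Sum>C\<in>su2_basis. ad_coeff A B y * ad_coeff A C y * left_inv_field C (left_inv_field B g) (x * y))"
    by (rule sum.swap)
  also have "\<dots> = (\<Sum>B\<in>su2_basis. \<Sum>C\<in>su2_basis. \<Sum>A\<in>su2_basis. ad_coeff A B y * ad_coeff A C y * left_inv_field C (left_inv_field B g) (x * y))"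
    by (intro sum.cong refl sum.swap)
  also have "\<dots> = (\<Sum>B\<in>su2_basis. \<Sum>C\<in>su2_basis. (if B = C then left_inv_field C (left_inv_field B g) (x * y) else 0))"
    by (intro sum.cong refl) (simp add: ad_coeff_orthogonal flip: sum_distrib_right)
  also have "\<dots> = (\<Sum>B\<in>su2_basis. left_inv_field B (left_inv_field B g) (x * y))"
    by (intro sum.cong refl) (simp add: sum.delta')
  finally show ?thesis .
qed

lemma bounded_linear_apply_bcontfun: "bounded_linear (\<lambda>f. apply_bcontfun f x :: real)"
  by (rule bounded_linear_intro[where K = 1]) (use norm_bounded[where 'b = real] in auto)

lemma bounded_linear_compose_su2:
  assumes \<phi>: "continuous_on UNIV (\<phi> :: su2 \<Rightarrow> su2)"
  shows "bounded_linear (\<lambda>f. Bcontfun (\<lambda>x. apply_bcontfun f (\<phi> x) :: real))"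
proof -
  have c: "continuous_on UNIV (\<lambda>x. apply_bcontfun f (\<phi> x) :: real)" for f
    by (intro continuous_on_compose2[OF continuous_on_apply_bcontfun \<phi>]) auto
  note * = bcontfun_su2[OF c]
  show ?thesis
  proof (rule bounded_linear_intro[where K = 1])
    show "norm (Bcontfun (\<lambda>x. apply_bcontfun f (\<phi> x) :: real)) \<le> norm f * 1" for f
      by (rule norm_bound) (use norm_bounded[where 'b = real] in \<open>simp add: *\<close>)
  qed (auto intro!: bcontfun_eqI simp: bcontfun_su2 continuous_intros c)
qed

section \<open>The maximum principle\<close>

lemma second_derivative_nonpos_at_max:
  fixes g :: "real \<Rightarrow> real"
  assumes g: "\<And>s. (g has_real_derivative g' s) (at s)" and g': "(g' has_real_derivative c) (at 0)"
    and max: "\<And>s. g s \<le> g 0"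
  shows "c \<le> 0"
proof (rule ccontr)
  assume "\<not> c \<le> 0"
  have "g' 0 = 0"
    using g[of 0] by (rule DERIV_local_max[of _ _ _ 1]) (use max in auto)
  obtain d where d: "d > 0" "\<And>h. 0 < h \<Longrightarrow> h < d \<Longrightarrow> g' 0 < g' (0 + h)"
    using DERIV_pos_inc_right[OF g'] \<open>\<not> c \<le> 0\<close> by auto
  obtain z where z: "0 < z" "z < d / 2" "g (d / 2) - g 0 = (d / 2 - 0) * g' z"
    using MVT2[of 0 "d / 2" g g'] g d(1) by auto
  have "d / 2 * g' z > 0"
    using d(1) d(2)[of z] \<open>g' 0 = 0\<close> z by (intro mult_pos_pos) auto
  then have "g (d / 2) - g 0 > 0" unfolding z(3) by simp
  then show False using max[of "d / 2"] by simp
qed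

text \<open>The maximum may be attained at the final time, so only earlier times are compared.\<close>

lemma left_derivative_nonneg:
  fixes g :: "real \<Rightarrow> real"
  assumes g: "(g has_real_derivative c) (at t)" and t: "0 < t" and max: "\<And>s. 0 \<le> s \<Longrightarrow> s \<le> t \<Longrightarrow> g s \<le> g t"
  shows "c \<ge> 0"
proof (rule ccontr)
  assume "\<not> c \<ge> 0"
  then obtain d where d: "d > 0" "\<And>h. 0 < h \<Longrightarrow> h < d \<Longrightarrow> g t < g (t - h)"
    using DERIV_neg_dec_left[OF g] by auto
  define m where "m = min (d / 2) t"
  have "0 < m" "m < d" "m \<le> t" using d(1) t by (auto simp: m_def)
  then show False using d(2)[of m] max[of "t - m"] by simp
qed

text \<open>If \<open>G\<close> were positive somewhere, then \<open>G - e t\<close> with small \<open>e > 0\<close> would have a maximum on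
\<open>[0, T] \<times> SU(2)\<close> at a positive time, where \<open>\<partial>\<^sub>t G \<ge> e\<close> but both second derivatives are nonpositive.\<close>

lemma su2_parabolic_maximum_principle:
  fixes G :: "real \<Rightarrow> su2 \<Rightarrow> real"
  assumes cont: "continuous_on ({0..T} \<times> UNIV) (\<lambda>(t, x). G t x)"
    and init: "\<And>x. G 0 x \<le> 0"
    and Gt: "\<And>t x. 0 < t \<Longrightarrow> t \<le> T \<Longrightarrow> ((\<lambda>t. G t x) has_real_derivative Gt t x) (at t)"
    and GX: "\<And>t x s. 0 < t \<Longrightarrow> t \<le> T \<Longrightarrow> ((\<lambda>s. G t (x * su2_exp su2_X s)) has_real_derivative GX t (x * su2_exp su2_X s)) (at s)"
    and GXX: "\<And>t x. 0 < t \<Longrightarrow> t \<le> T \<Longrightarrow> ((\<lambda>s. GX t (x * su2_exp su2_X s)) has_real_derivative GXX t x) (at 0)"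
    and GY: "\<And>t x s. 0 < t \<Longrightarrow> t \<le> T \<Longrightarrow> ((\<lambda>s. G t (x * su2_exp su2_Y s)) has_real_derivative GY t (x * su2_exp su2_Y s)) (at s)"
    and GYY: "\<And>t x. 0 < t \<Longrightarrow> t \<le> T \<Longrightarrow> ((\<lambda>s. GY t (x * su2_exp su2_Y s)) has_real_derivative GYY t x) (at 0)"
    and sub: "\<And>t x. 0 < t \<Longrightarrow> t \<le> T \<Longrightarrow> Gt t x \<le> GXX t x + GYY t x"
    and t: "0 \<le> t" "t \<le> T"
  shows "G t x \<le> 0"
proof (rule ccontr)
  assume pos: "\<not> G t x \<le> 0"
  define e where "e = (G t x / 2) / (T + 1)"
  have T1: "T + 1 > 0" using t by simp
  have e: "e > 0" using pos t by (auto simp: e_def intro!: divide_pos_pos)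
  have "e * (T + 1) = G t x / 2" using T1 by (intro nonzero_eq_divide_eq[THEN iffD1, OF _ e_def]) simp
  then have e2: "e * (T + 1) < G t x" using pos by simp
  define H where "H = (\<lambda>p. G (fst p) (snd p) - e * fst p)"
  have "continuous_on ({0..T} \<times> UNIV) H"
    using cont unfolding H_def split_beta by (intro continuous_intros)
  moreover have "compact ({0..T} \<times> (UNIV :: su2 set))" by (intro compact_Times compact_UNIV_su2) auto
  ultimately obtain p where p: "p \<in> {0..T} \<times> UNIV" "\<And>q. q \<in> {0..T} \<times> UNIV \<Longrightarrow> H q \<le> H p"
    using continuous_attains_sup[of "{0..T} \<times> UNIV" H] t by auto
  obtain t0 x0 where p0: "p = (t0, x0)" by (cases p)
  have le: "G s y - e * s \<le> G t0 x0 - e * t0" if "0 \<le> s" "s \<le> T" for s y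
    using p(2)[of "(s, y)"] that by (simp add: H_def p0)
  have "e * t \<le> e * T" using t e by simp
  then have "e * t < G t x" using e e2 distrib_left[of e T 1] by linarith
  then have "G t0 x0 - e * t0 > 0" using le[OF t, of x] by simp
  then have t0: "0 < t0" "t0 \<le> T"
    using p(1) init[of x0] by (cases "t0 = 0"; auto simp: p0)+
  have "Gt t0 x0 - e \<ge> 0"
  proof (rule left_derivative_nonneg[OF _ t0(1)])
    show "((\<lambda>s. G s x0 - e * s) has_real_derivative Gt t0 x0 - e) (at t0)"
      by (auto intro!: derivative_eq_intros Gt t0)
    show "G s x0 - e * s \<le> G t0 x0 - e * t0" if "0 \<le> s" "s \<le> t0" for s
      using that t0 by (intro le) auto
  qed
  moreover have mx: "G t0 y \<le> G t0 x0" for y using le[of t0 y] t0 by simp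
  have "GXX t0 x0 \<le> 0"
    by (rule second_derivative_nonpos_at_max[OF GX[OF t0] GXX[OF t0]]) (simp add: mx)
  moreover have "GYY t0 x0 \<le> 0"
    by (rule second_derivative_nonpos_at_max[OF GY[OF t0] GYY[OF t0]]) (simp add: mx)
  ultimately show False using sub[OF t0, of x0] e by simp
qed

section \<open>The differential inequality at a point\<close>

text \<open>The quantity to which the maximum principle is applied; the arguments \<open>p, q, z, l\<close> stand for
\<open>X u, Y u, Z u, L u\<close>.\<close>

definition li_yau_functional :: "real \<Rightarrow> real \<Rightarrow> real \<Rightarrow> real \<Rightarrow> real \<Rightarrow> real \<Rightarrow> real \<Rightarrow> real \<Rightarrow> real \<Rightarrow> real" where
  "li_yau_functional a b A B u p q z l = (a * (p\<^sup>2 + q\<^sup>2) + b * z\<^sup>2) / u + A * l - B * u"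

text \<open>The derivative of \<open>li_yau_functional\<close> along a curve on which the coefficients are constant; the
suffix \<open>1\<close> marks derivatives along the curve.\<close>

definition li_yau_derivative :: "real \<Rightarrow> real \<Rightarrow> real \<Rightarrow> real \<Rightarrow> real \<Rightarrow> real \<Rightarrow> real \<Rightarrow> real \<Rightarrow>
    real \<Rightarrow> real \<Rightarrow> real \<Rightarrow> real \<Rightarrow> real \<Rightarrow> real" where
  "li_yau_derivative a b A B u p q z u1 p1 q1 z1 l1 = (2 * a * (p * p1 + q * q1) + 2 * b * (z * z1)) / u
    - (a * (p\<^sup>2 + q\<^sup>2) + b * z\<^sup>2) * u1 / u\<^sup>2 + A * l1 - B * u1"

definition li_yau_second_derivative :: "real \<Rightarrow> real \<Rightarrow> real \<Rightarrow> real \<Rightarrow> real \<Rightarrow> real \<Rightarrow> real \<Rightarrow> real \<Rightarrow>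
    real \<Rightarrow> real \<Rightarrow> real \<Rightarrow> real \<Rightarrow> real \<Rightarrow> real \<Rightarrow> real \<Rightarrow> real \<Rightarrow> real \<Rightarrow> real" where
  "li_yau_second_derivative a b A B u p q z u1 p1 q1 z1 u2 p2 q2 z2 l2 =
    (2 * a * (p1\<^sup>2 + p * p2 + q1\<^sup>2 + q * q2) + 2 * b * (z1\<^sup>2 + z * z2)) / u
    - 2 * (2 * a * (p * p1 + q * q1) + 2 * b * (z * z1)) * u1 / u\<^sup>2
    - (a * (p\<^sup>2 + q\<^sup>2) + b * z\<^sup>2) * u2 / u\<^sup>2 + 2 * (a * (p\<^sup>2 + q\<^sup>2) + b * z\<^sup>2) * u1\<^sup>2 / u ^ 3
    + A * l2 - B * u2"

text \<open>The functional is linear in its coefficients, so their variation contributes the functional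
itself with the coefficients differentiated.\<close>

lemma li_yau_functional_has_derivative:
  fixes u p q z l a b A B :: "real \<Rightarrow> real"
  assumes "u s \<noteq> 0"
    "(u has_real_derivative u1) (at s)" "(p has_real_derivative p1) (at s)" "(q has_real_derivative q1) (at s)"
    "(z has_real_derivative z1) (at s)" "(l has_real_derivative l1) (at s)"
    "(a has_real_derivative a1) (at s)" "(b has_real_derivative b1) (at s)"
    "(A has_real_derivative A1) (at s)" "(B has_real_derivative B1) (at s)"
  shows "((\<lambda>s. li_yau_functional (a s) (b s) (A s) (B s) (u s) (p s) (q s) (z s) (l s)) has_real_derivative
    li_yau_derivative (a s) (b s) (A s) (B s) (u s) (p s) (q s) (z s) u1 p1 q1 z1 l1
     + li_yau_functional a1 b1 A1 B1 (u s) (p s) (q s) (z s) (l s)) (at s)"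
  unfolding li_yau_functional_def li_yau_derivative_def
  by (rule derivative_eq_intros assms refl)+ (use assms(1) in \<open>simp add: field_simps power2_eq_square\<close>)

lemma li_yau_derivative_has_derivative:
  fixes u p q z u1 p1 q1 z1 l1 :: "real \<Rightarrow> real"
  assumes "u s \<noteq> 0"
    "(u has_real_derivative u1 s) (at s)" "(p has_real_derivative p1 s) (at s)" "(q has_real_derivative q1 s) (at s)"
    "(z has_real_derivative z1 s) (at s)"
    "(u1 has_real_derivative u2) (at s)" "(p1 has_real_derivative p2) (at s)" "(q1 has_real_derivative q2) (at s)"
    "(z1 has_real_derivative z2) (at s)" "(l1 has_real_derivative l2) (at s)"
  shows "((\<lambda>s. li_yau_derivative a b A B (u s) (p s) (q s) (z s) (u1 s) (p1 s) (q1 s) (z1 s) (l1 s)) has_real_derivative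
    li_yau_second_derivative a b A B (u s) (p s) (q s) (z s) (u1 s) (p1 s) (q1 s) (z1 s) u2 p2 q2 z2 l2) (at s)"
proof -
  have u2: "(u s)\<^sup>2 \<noteq> 0" using assms(1) by simp
  show ?thesis
  unfolding li_yau_derivative_def li_yau_second_derivative_def
  by (rule derivative_eq_intros assms u2 refl)+
    (use assms(1) in \<open>simp add: field_simps power2_eq_square power3_eq_cube\<close>)
qed

text \<open>The curvature-dimension inequality in the form needed for the maximum principle. In the names,
\<open>uXY\<close> is \<open>X (Y u)\<close>, \<open>zX\<close> is \<open>X (Z u)\<close>, \<open>pXX\<close> is \<open>X (X (X u))\<close> and so on, and the suffix \<open>t\<close> marks time
derivatives. The assumptions on \<open>pt, qt, zt\<close> are the heat equation commuted with the fields. After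
division by \<open>u\<close>, the difference of the two sides is a combination, with nonnegative coefficients, of
squares of linear expressions in the first and second derivatives of \<open>ln u\<close> and \<open>\<gamma>\<close> (here \<open>g\<close>).\<close>

lemma li_yau_parabolic_inequality:
  fixes u p q z l a b :: real
  assumes u: "u > 0" and a: "a > 0" and b: "b > 0"
    and coeff: "b1 = 4 * a" "A1 = 2 * a * g" "B1 = a * g\<^sup>2" "a1 + 8 * a\<^sup>2 / b - 8 * a + A1 \<le> 0"
    and comm: "uXY - uYX = 2 * z"
    and ut: "ut = l" "l = uXX + uYY"
    and pt: "pt = pXX + pYY + 4 * zY - 4 * p"
    and qt: "qt = qXX + qYY - 4 * zX - 4 * q"
    and zt: "zt = zXX + zYY" and lt: "lt = lXX + lYY"
  shows "li_yau_derivative a b A B u p q z ut pt qt zt lt + li_yau_functional a1 b1 A1 B1 u p q z l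
    \<le> li_yau_second_derivative a b A B u p q z p uXX uXY zX uXX pXX qXX zXX lXX
      + li_yau_second_derivative a b A B u p q z q uYX uYY zY uYY pYY qYY zYY lYY"
proof -
  define r where "r = 1 / u"
  \<comment> \<open>the first derivatives of \<open>ln u\<close>, its Hessian \<open>h\<close>, and the horizontal derivatives \<open>g\<close> of \<open>Z ln u\<close>; by the commutator relation \<open>Z ln u = (h12 - h21) / 2\<close>\<close>
  define P Q where "P = p * r" and "Q = q * r"
  define h11 h22 h12 h21 where "h11 = uXX * r - P\<^sup>2" and "h22 = uYY * r - Q\<^sup>2"
    and "h12 = uXY * r - P * Q" and "h21 = uYX * r - P * Q"
  define g1 g2 where "g1 = zX * r - P * (h12 - h21) / 2" and "g2 = zY * r - Q * (h12 - h21) / 2"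
  have s: "p = u * P" "q = u * Q" "uXX = u * (h11 + P\<^sup>2)" "uYY = u * (h22 + Q\<^sup>2)"
    "uXY = u * (h12 + P * Q)" "uYX = u * (h21 + P * Q)"
    "zX = u * (g1 + P * (h12 - h21) / 2)" "zY = u * (g2 + Q * (h12 - h21) / 2)"
    using u by (simp_all add: P_def Q_def h11_def h22_def h12_def h21_def g1_def g2_def r_def)
  have z: "z = u * ((h12 - h21) / 2)" using comm s(5,6) by (simp add: algebra_simps)
  \<comment> \<open>each square completes one group of terms: the diagonal of the Hessian of \<open>ln u\<close>, its symmetric off-diagonal part, and the horizontal derivatives of \<open>Z ln u\<close>\<close>
  define E where "E = 2 * a * (h11 - g / 2)\<^sup>2 + 2 * a * (h22 - g / 2)\<^sup>2 + a * (h12 + h21)\<^sup>2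
    + 2 * b * (g1 + 2 * a * Q / b)\<^sup>2 + 2 * b * (g2 - 2 * a * P / b)\<^sup>2
    - (a1 + 8 * a\<^sup>2 / b - 8 * a + A1) * (P\<^sup>2 + Q\<^sup>2)"
  have "E \<ge> 0"
    unfolding E_def using a b coeff(4)
    by (smt (verit) mult_nonneg_nonneg mult_nonpos_nonneg zero_le_power2)
  moreover have "li_yau_second_derivative a b A B u p q z p uXX uXY zX uXX pXX qXX zXX lXX
      + li_yau_second_derivative a b A B u p q z q uYX uYY zY uYY pYY qYY zYY lYY
      - (li_yau_derivative a b A B u p q z ut pt qt zt lt + li_yau_functional a1 b1 A1 B1 u p q z l) = u * E"
    using u b
    unfolding li_yau_derivative_def li_yau_second_derivative_def li_yau_functional_def E_def pt qt zt lt ut coeff(1-3) s z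
    by (simp add: field_simps power2_eq_square power3_eq_cube)
  ultimately show ?thesis using u by (smt (verit) mult_nonneg_nonneg)
qed

section \<open>Regularity of the heat flow\<close>

locale su2_heat =
  fixes P :: "real \<Rightarrow> (su2 \<Rightarrow>\<^sub>C real) \<Rightarrow> (su2 \<Rightarrow>\<^sub>C real)"
  assumes heat: "heat_semigroup P"
begin

abbreviation (input) X where "X \<equiv> su2_X"
abbreviation (input) Y where "Y \<equiv> su2_Y"
abbreviation (input) Z where "Z \<equiv> su2_Z"

lemma c0: "c0_semigroup P" using heat by (simp add: heat_semigroup_def)

lemma smooth_in_generator:
  assumes "smooth_su2 g"
  shows "(Bcontfun g, Bcontfun (subLaplacian g)) \<in> generator P"
  using heat assms
  by (auto simp: heat_semigroup_def bcontfun_su2 smooth_su2_continuous continuous_on_subLaplacian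
      intro!: subsetD[OF closure_subset])

text \<open>Composition with \<open>\<phi>\<close> maps the graph of \<open>L\<close> on smooth functions into itself, hence also its closure,
the generator. This is applied to left translations and to right translations by \<open>exp (s Z)\<close>.\<close>

lemma heat_commutes_with_symmetry:
  assumes \<phi>: "continuous_on UNIV \<phi>" and sm: "\<And>g. smooth_su2 g \<Longrightarrow> smooth_su2 (\<lambda>x. g (\<phi> x))"
    and L: "\<And>g. smooth_su2 g \<Longrightarrow> subLaplacian (\<lambda>x. g (\<phi> x)) = (\<lambda>x. subLaplacian g (\<phi> x))"
    and f: "smooth_su2 f" and t: "t \<ge> 0"
  shows "apply_bcontfun (P t (Bcontfun f)) (\<phi> x) = apply_bcontfun (P t (Bcontfun (\<lambda>x. f (\<phi> x)))) x"
proof -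
  define T where "T h = Bcontfun (\<lambda>x. apply_bcontfun h (\<phi> x) :: real)" for h
  have T: "bounded_linear T" unfolding T_def by (rule bounded_linear_compose_su2[OF \<phi>])
  have appT: "apply_bcontfun (T h) = (\<lambda>x. apply_bcontfun h (\<phi> x))" for h
    unfolding T_def by (intro bcontfun_su2 continuous_on_compose2[OF continuous_on_apply_bcontfun \<phi>]) auto
  define G where "G = {(g, h). smooth_su2 (apply_bcontfun g) \<and> apply_bcontfun h = subLaplacian (apply_bcontfun g)}"
  have gen: "generator P = closure G" using heat by (simp add: heat_semigroup_def G_def)
  have "bounded_linear (\<lambda>p. (T (fst p), T (snd p)))"
    by (intro bounded_linear_Pair bounded_linear_compose[OF T] bounded_linear_fst bounded_linear_snd)
  then have "continuous_on (closure G) (\<lambda>p. (T (fst p), T (snd p)))"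
    by (rule linear_continuous_on)
  moreover have "(\<lambda>p. (T (fst p), T (snd p))) ` G \<subseteq> closure G"
    using sm L by (force simp: G_def appT intro!: subsetD[OF closure_subset])
  ultimately have "(\<lambda>p. (T (fst p), T (snd p))) ` closure G \<subseteq> closure G"
    by (intro image_closure_subset) auto
  then have "(T g, T h) \<in> generator P" if "(g, h) \<in> generator P" for g h
    using that by (force simp: gen)
  then have "T (P t (Bcontfun f)) = P t (T (Bcontfun f))"
    by (rule semigroup_commute[OF c0 t T _ smooth_in_generator[OF f]])
  moreover have "T (Bcontfun f) = Bcontfun (\<lambda>x. f (\<phi> x))"
    by (simp add: T_def bcontfun_su2 smooth_su2_continuous[OF f])
  ultimately show ?thesis using appT[of "P t (Bcontfun f)"] by simp
qed

definition heat_at_one :: "real \<Rightarrow> (su2 \<Rightarrow> real) \<Rightarrow> real" where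
  "heat_at_one t k = apply_bcontfun (P t (Bcontfun k)) su2_one"

lemma bounded_linear_heat_at_one:
  "t \<ge> 0 \<Longrightarrow> bounded_linear (\<lambda>h. apply_bcontfun (P t h) su2_one)"
  using bounded_linear_compose[OF bounded_linear_apply_bcontfun c0_semigroupD(1)[OF c0]] .

lemma heat_at_one_sum_cmult:
  assumes t: "t \<ge> 0" and k: "\<And>i. i \<in> I \<Longrightarrow> continuous_on UNIV (k i)"
  shows "heat_at_one t (\<lambda>y. \<Sum>i\<in>I. c i * k i y) = (\<Sum>i\<in>I. c i * heat_at_one t (k i))"
proof -
  have "Bcontfun (\<lambda>y. \<Sum>i\<in>I. c i * k i y) = (\<Sum>i\<in>I. c i *\<^sub>R Bcontfun (k i))"
  proof (rule bcontfun_eqI)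
    fix y
    have "apply_bcontfun (\<Sum>i\<in>I. c i *\<^sub>R Bcontfun (k i)) y = (\<Sum>i\<in>I. apply_bcontfun (c i *\<^sub>R Bcontfun (k i)) y)"
      by (rule linear_sum[OF bounded_linear.linear[OF bounded_linear_apply_bcontfun]])
    then show "apply_bcontfun (Bcontfun (\<lambda>y. \<Sum>i\<in>I. c i * k i y)) y = apply_bcontfun (\<Sum>i\<in>I. c i *\<^sub>R Bcontfun (k i)) y"
      using k by (simp add: bcontfun_su2 continuous_intros)
  qed
  moreover note lin = bounded_linear.linear[OF bounded_linear_heat_at_one[OF t]]
  ultimately show ?thesis
    unfolding heat_at_one_def by (simp add: linear_sum[OF lin] linear_scale[OF lin, simplified])
qed

lemma heat_at_one_diff_cmult:
  assumes t: "t \<ge> 0" and "continuous_on UNIV k" "continuous_on UNIV l"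
  shows "heat_at_one t (\<lambda>y. k y - l y) = heat_at_one t k - heat_at_one t l"
    "heat_at_one t (\<lambda>y. c * k y) = c * heat_at_one t k"
  using heat_at_one_sum_cmult[OF t, of "{True, False}" "\<lambda>b. if b then k else l" "\<lambda>b. if b then 1 else - 1"]
    heat_at_one_sum_cmult[OF t, of "{True}" "\<lambda>_. k" "\<lambda>_. c"] assms
  by simp_all

lemma heat_at_one_has_real_derivative:
  fixes k k' :: "real \<Rightarrow> su2 \<Rightarrow> real"
  assumes "t \<ge> 0" "\<And>s. continuous_on UNIV (k s)" "continuous_on UNIV (\<lambda>(s, y). k' s y)"
    "\<And>s y. ((\<lambda>s. k s y) has_real_derivative k' s y) (at s)"
  shows "((\<lambda>s. heat_at_one t (k s)) has_real_derivative heat_at_one t (k' s0)) (at s0)"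
  unfolding heat_at_one_def has_real_derivative_iff_has_vector_derivative
  by (intro bounded_linear.has_vector_derivative[OF bounded_linear_heat_at_one]
      Bcontfun_su2_has_vector_derivative assms)

text \<open>The derivative of \<open>P\<^sub>t f\<close> along the word \<open>W\<close> of fields, with the derivatives already taken under the
functional. The first field of the word is the last one to be applied.\<close>

definition heat_deriv :: "(su2 \<Rightarrow> real) \<Rightarrow> (complex^2^2) list \<Rightarrow> real \<Rightarrow> su2 \<Rightarrow> real" where
  "heat_deriv f W t x = heat_at_one t (\<lambda>y. foldr left_inv_field W (\<lambda>z. f (z * y)) x)"

lemma continuous_on_kernel:
  assumes "smooth_su2 f" "set W \<subseteq> su2_basis"
  shows "continuous_on UNIV (\<lambda>y. foldr left_inv_field W (\<lambda>z. f (z * y)) x)"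
  by (rule continuous_on_compose2[OF continuous_on_foldr_field_right_translate[OF assms], of _ "Pair x", simplified])
    (auto intro!: continuous_intros)

text \<open>Translate \<open>x\<close> to the identity.\<close>

lemma heat_eq_heat_deriv_Nil:
  assumes "smooth_su2 f" "t \<ge> 0"
  shows "apply_bcontfun (P t (Bcontfun f)) x = heat_deriv f [] t x"
  using heat_commutes_with_symmetry[of "\<lambda>z. x * z" f t su2_one] assms
  by (simp add: heat_deriv_def heat_at_one_def continuous_intros smooth_su2_left_translate
      subLaplacian_left_translate)

lemma continuous_on_heat_deriv:
  assumes "smooth_su2 f" "set W \<subseteq> su2_basis"
  shows "continuous_on ({0..} \<times> UNIV) (\<lambda>(t, x). heat_deriv f W t x)"
proof -
  have "continuous_on UNIV (\<lambda>x. Bcontfun (\<lambda>y. foldr left_inv_field W (\<lambda>z. f (z * y)) x))"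
    by (rule continuous_on_Bcontfun_su2) (rule continuous_on_foldr_field_right_translate[OF assms])
  then have "continuous_on ({0..} \<times> UNIV) (\<lambda>p. P (fst p) (Bcontfun (\<lambda>y. foldr left_inv_field W (\<lambda>z. f (z * y)) (snd p))))"
    by (intro continuous_on_compose2[OF c0_semigroup_continuous_on[OF c0, unfolded split_beta],
          of _ "\<lambda>p. (fst p, Bcontfun (\<lambda>y. foldr left_inv_field W (\<lambda>z. f (z * y)) (snd p)))", simplified])
      (auto intro!: continuous_intros elim!: continuous_on_compose2)
  then show ?thesis
    unfolding heat_deriv_def heat_at_one_def split_beta
    by (rule continuous_on_compose2[OF linear_continuous_on[OF bounded_linear_apply_bcontfun, of UNIV]]) simp
qed

text \<open>Differentiation in \<open>x\<close> under the functional. It is legitimate because the kernel is differentiable in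
the supremum norm with respect to \<open>y\<close>.\<close>

lemma heat_deriv_Cons:
  assumes f: "smooth_su2 f" and W: "set W \<subseteq> su2_basis" and A: "A \<in> su2_basis" and t: "t \<ge> 0"
  shows "((\<lambda>s. heat_deriv f W t (x * su2_exp A s)) has_real_derivative heat_deriv f (A # W) t (x * su2_exp A s)) (at s)"
  unfolding heat_deriv_def
proof (intro heat_at_one_has_real_derivative t continuous_on_kernel f W)
  have "continuous_on UNIV (\<lambda>(x, y). foldr left_inv_field (A # W) (\<lambda>z. f (z * y)) x)"
    using f W A by (intro continuous_on_foldr_field_right_translate) auto
  moreover have "continuous_on UNIV (\<lambda>p :: real \<times> su2. (x * su2_exp A (fst p), snd p))"
    by (intro continuous_intros A)
  ultimately show "continuous_on UNIV (\<lambda>(s, y). foldr left_inv_field (A # W) (\<lambda>z. f (z * y)) (x * su2_exp A s))"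
    using continuous_on_compose2 by (fastforce simp: split_beta)
  show "((\<lambda>s. foldr left_inv_field W (\<lambda>z. f (z * y)) (x * su2_exp A s)) has_real_derivative
      foldr left_inv_field (A # W) (\<lambda>z. f (z * y)) (x * su2_exp A s)) (at s)" for s y
    using smooth_su2_has_field_derivative[OF smooth_su2_foldr_field[OF smooth_su2_right_translate[OF f] W] A]
    by simp
qed

lemma left_inv_field_heat_deriv:
  assumes f: "smooth_su2 f" and W: "set W \<subseteq> su2_basis" and A: "A \<in> su2_basis" and t: "t \<ge> 0"
  shows "left_inv_field A (heat_deriv f W t) = heat_deriv f (A # W) t"
proof
  fix x show "left_inv_field A (heat_deriv f W t) x = heat_deriv f (A # W) t x"
    using heat_deriv_Cons[OF assms, of x 0] A by (intro left_inv_fieldI A) simp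
qed

lemma heat_deriv_commutators:
  assumes f: "smooth_su2 f" and W: "set W \<subseteq> su2_basis" and t: "t \<ge> 0"
  shows "heat_deriv f (su2_X # su2_Y # W) t x - heat_deriv f (su2_Y # su2_X # W) t x = 2 * heat_deriv f (su2_Z # W) t x"
    "heat_deriv f (su2_Y # su2_Z # W) t x - heat_deriv f (su2_Z # su2_Y # W) t x = 2 * heat_deriv f (su2_X # W) t x"
    "heat_deriv f (su2_Z # su2_X # W) t x - heat_deriv f (su2_X # su2_Z # W) t x = 2 * heat_deriv f (su2_Y # W) t x"
proof -
  have sm: "smooth_su2 (foldr left_inv_field W (\<lambda>z. f (z * y)))" for y
    by (intro smooth_su2_foldr_field smooth_su2_right_translate f W)
  have c: "continuous_on UNIV (\<lambda>y. foldr left_inv_field V (\<lambda>z. f (z * y)) x)" if "set V \<subseteq> su2_basis" for V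
    using continuous_on_kernel[OF f that] .
  have *: "heat_deriv f U t x - heat_deriv f V t x = 2 * heat_deriv f V' t x"
    if "set U \<subseteq> su2_basis" "set V \<subseteq> su2_basis" "set V' \<subseteq> su2_basis"
      and eq: "\<And>y. foldr left_inv_field U (\<lambda>z. f (z * y)) x - foldr left_inv_field V (\<lambda>z. f (z * y)) x
        = 2 * foldr left_inv_field V' (\<lambda>z. f (z * y)) x" for U V V'
  proof -
    have "heat_deriv f U t x - heat_deriv f V t x
        = heat_at_one t (\<lambda>y. 2 * foldr left_inv_field V' (\<lambda>z. f (z * y)) x)"
      unfolding heat_deriv_def eq[symmetric] by (intro heat_at_one_diff_cmult(1)[symmetric] t c that)
    also have "\<dots> = 2 * heat_deriv f V' t x"
      unfolding heat_deriv_def by (intro heat_at_one_diff_cmult(2)[OF t c[OF that(3)] c[OF that(3)]])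
    finally show ?thesis .
  qed
  show "heat_deriv f (su2_X # su2_Y # W) t x - heat_deriv f (su2_Y # su2_X # W) t x = 2 * heat_deriv f (su2_Z # W) t x"
    "heat_deriv f (su2_Y # su2_Z # W) t x - heat_deriv f (su2_Z # su2_Y # W) t x = 2 * heat_deriv f (su2_X # W) t x"
    "heat_deriv f (su2_Z # su2_X # W) t x - heat_deriv f (su2_X # su2_Z # W) t x = 2 * heat_deriv f (su2_Y # W) t x"
    by (rule *; use W in \<open>simp add: su2_commutators[OF sm]\<close>)+
qed

text \<open>Right translation by \<open>exp (s Z)\<close> commutes with \<open>P\<^sub>t\<close>, so \<open>P\<^sub>t f (x exp(sZ))\<close> can be differentiated in
two ways.\<close>

lemma heat_deriv_Z:
  assumes f: "smooth_su2 f" and t: "t \<ge> 0"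
  shows "heat_deriv f [su2_Z] t x = heat_deriv (left_inv_field su2_Z f) [] t x"
proof -
  have "heat_deriv f [] t (x * su2_exp su2_Z s) = heat_at_one t (\<lambda>y. f (x * y * su2_exp su2_Z s))" for s
  proof -
    have "heat_deriv f [] t (x * su2_exp su2_Z s) = apply_bcontfun (P t (Bcontfun (\<lambda>y. f (y * su2_exp su2_Z s)))) x"
      using heat_commutes_with_symmetry[of "\<lambda>z. z * su2_exp su2_Z s" f t x] f t
      by (simp add: continuous_intros smooth_su2_right_translate subLaplacian_right_translate_exp_Z
          flip: heat_eq_heat_deriv_Nil)
    also have "\<dots> = heat_deriv (\<lambda>y. f (y * su2_exp su2_Z s)) [] t x"
      by (intro heat_eq_heat_deriv_Nil smooth_su2_right_translate f t)
    finally show ?thesis by (simp add: heat_deriv_def)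
  qed
  moreover have "((\<lambda>s. heat_at_one t (\<lambda>y. f (x * y * su2_exp su2_Z s))) has_real_derivative
      heat_at_one t (\<lambda>y. left_inv_field su2_Z f (x * y * su2_exp su2_Z 0))) (at 0)"
  proof (rule heat_at_one_has_real_derivative[OF t])
    show "continuous_on UNIV (\<lambda>y. f (x * y * su2_exp su2_Z s))" for s
      by (rule continuous_on_compose2[OF smooth_su2_continuous[OF f]]) (auto intro!: continuous_intros)
    show "continuous_on UNIV (\<lambda>(s, y). left_inv_field su2_Z f (x * y * su2_exp su2_Z s))"
      unfolding split_beta
      by (rule continuous_on_compose2[OF smooth_su2_continuous[OF smooth_su2_left_inv_field[OF f]]])
        (auto intro!: continuous_intros)
    show "((\<lambda>s. f (x * y * su2_exp su2_Z s)) has_real_derivative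
        left_inv_field su2_Z f (x * y * su2_exp su2_Z s)) (at s)" for s y
      by (rule smooth_su2_has_field_derivative[OF f]) simp
  qed
  ultimately have "((\<lambda>s. heat_deriv f [] t (x * su2_exp su2_Z s)) has_real_derivative
      heat_deriv (left_inv_field su2_Z f) [] t x) (at 0)"
    by (simp add: heat_deriv_def)
  then show ?thesis
    using heat_deriv_Cons[OF f _ _ t, of "[]" su2_Z x 0] DERIV_unique by fastforce
qed

text \<open>\<open>L P\<^sub>t f = P\<^sub>t L f\<close>: both \<open>X\<^sup>2 + Y\<^sup>2 + Z\<^sup>2\<close> and \<open>Z\<^sup>2\<close> commute with \<open>P\<^sub>t\<close>.\<close>

lemma heat_deriv_subLaplacian:
  assumes f: "smooth_su2 f" and t: "t \<ge> 0"
  shows "heat_deriv f [su2_X, su2_X] t x + heat_deriv f [su2_Y, su2_Y] t x = heat_deriv (subLaplacian f) [] t x"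
proof -
  have sZ: "smooth_su2 (left_inv_field su2_Z f)" using smooth_su2_left_inv_field[OF f] by simp
  have "heat_deriv f [su2_Z, su2_Z] t x = left_inv_field su2_Z (heat_deriv f [su2_Z] t) x"
    using left_inv_field_heat_deriv[OF f _ _ t, of "[su2_Z]" su2_Z] by simp
  also have "heat_deriv f [su2_Z] t = heat_deriv (left_inv_field su2_Z f) [] t"
    using heat_deriv_Z[OF f t] by blast
  also have "left_inv_field su2_Z (heat_deriv (left_inv_field su2_Z f) [] t) x = heat_deriv (left_inv_field su2_Z f) [su2_Z] t x"
    using left_inv_field_heat_deriv[OF sZ _ _ t, of "[]" su2_Z] by simp
  also have "\<dots> = heat_deriv (left_inv_field su2_Z (left_inv_field su2_Z f)) [] t x"
    by (rule heat_deriv_Z[OF sZ t])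
  finally have ZZ: "heat_deriv f [su2_Z, su2_Z] t x = heat_deriv (left_inv_field su2_Z (left_inv_field su2_Z f)) [] t x" .
  have ck: "continuous_on UNIV (\<lambda>y. foldr left_inv_field [A, A] (\<lambda>z. f (z * y)) x)" if "A \<in> su2_basis" for A
    using that by (intro continuous_on_kernel f) auto
  have cAA: "continuous_on UNIV (\<lambda>y. left_inv_field A (left_inv_field A f) (x * y))" if "A \<in> su2_basis" for A
    by (rule continuous_on_compose2[OF smooth_su2_continuous[OF smooth_su2_left_inv_field[OF smooth_su2_left_inv_field[OF f that] that]]])
      (auto intro!: continuous_intros)
  have "(\<Sum>A\<in>su2_basis. heat_deriv f [A, A] t x)
      = heat_at_one t (\<lambda>y. \<Sum>A\<in>su2_basis. left_inv_field A (left_inv_field A (\<lambda>z. f (z * y))) x)"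
    using heat_at_one_sum_cmult[OF t ck, of su2_basis "\<lambda>A. A" "\<lambda>_. 1"] by (simp add: heat_deriv_def)
  also have "\<dots> = heat_at_one t (\<lambda>y. \<Sum>A\<in>su2_basis. left_inv_field A (left_inv_field A f) (x * y))"
    by (simp add: Casimir_right_translate[OF f])
  finally have "heat_deriv f [su2_X, su2_X] t x + heat_deriv f [su2_Y, su2_Y] t x
    = heat_at_one t (\<lambda>y. \<Sum>A\<in>su2_basis. left_inv_field A (left_inv_field A f) (x * y))
      - heat_at_one t (\<lambda>y. left_inv_field su2_Z (left_inv_field su2_Z f) (x * y))"
    using ZZ by (simp add: sum_su2_basis heat_deriv_def)
  also have "\<dots> = heat_at_one t (\<lambda>y. subLaplacian f (x * y))"
    unfolding subLaplacian_Casimir by (rule heat_at_one_diff_cmult(1)[symmetric]) (intro t cAA continuous_intros; simp)+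
  finally show ?thesis by (simp add: heat_deriv_def)
qed

lemma heat_deriv_Nil_time:
  assumes f: "smooth_su2 f" and t: "t > 0"
  shows "((\<lambda>t. heat_deriv f [] t x) has_real_derivative heat_deriv (subLaplacian f) [] t x) (at t)"
proof -
  have "((\<lambda>t. P t (Bcontfun (\<lambda>y. f (x * y)))) has_vector_derivative P t (Bcontfun (subLaplacian (\<lambda>y. f (x * y))))) (at t within {0..})"
    using t by (intro semigroup_has_vector_derivative c0 smooth_in_generator smooth_su2_left_translate f) simp
  then have "((\<lambda>t. heat_deriv f [] t x) has_real_derivative heat_deriv (subLaplacian f) [] t x) (at t within {0..})"
    unfolding has_real_derivative_iff_has_vector_derivative heat_deriv_def heat_at_one_def
    by (auto simp: subLaplacian_left_translate intro: bounded_linear.has_vector_derivative[OF bounded_linear_apply_bcontfun])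
  moreover have "at t within {0..} = at t"
    using t by (intro at_within_interior) simp
  ultimately show ?thesis by simp
qed

text \<open>The heat equation may be differentiated once in space. The mixed derivative \<open>\<partial>\<^sub>t A\<close> is obtained from
\<open>A \<partial>\<^sub>t\<close>, which is continuous.\<close>

lemma heat_deriv_singleton_time:
  assumes f: "smooth_su2 f" and A: "A \<in> su2_basis" and t: "t > 0"
  shows "((\<lambda>t. heat_deriv f [A] t x) has_real_derivative heat_deriv (subLaplacian f) [A] t x) (at t)"
proof -
  have sL: "smooth_su2 (subLaplacian f)" by (rule smooth_su2_subLaplacian[OF f])
  have "((\<lambda>t. heat_deriv f [A] t x) has_real_derivative
      (\<lambda>t s. heat_deriv (subLaplacian f) [A] t (x * su2_exp A s)) t 0) (at t)"
  proof (rule has_real_derivative_mixed_partial[where a = "t / 2" and b = "t + 1"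
      and \<phi> = "\<lambda>t s. heat_deriv f [] t (x * su2_exp A s)"
      and \<psi> = "\<lambda>t s. heat_deriv (subLaplacian f) [] t (x * su2_exp A s)"
      and \<psi>s = "\<lambda>t s. heat_deriv (subLaplacian f) [A] t (x * su2_exp A s)"])
    show "((\<lambda>r. heat_deriv f [] r (x * su2_exp A s)) has_real_derivative
      heat_deriv (subLaplacian f) [] r (x * su2_exp A s)) (at r)" if "r \<in> {t/2..t+1}" for r s
      using that t by (intro heat_deriv_Nil_time f) auto
    show "((\<lambda>s. heat_deriv f [] r (x * su2_exp A s)) has_real_derivative heat_deriv f [A] r x) (at 0)"
      if "r \<in> {t/2..t+1}" for r
      using heat_deriv_Cons[OF f _ A, of "[]" r x 0] that t A by simp
    show "((\<lambda>s. heat_deriv (subLaplacian f) [] r (x * su2_exp A s)) has_real_derivative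
      heat_deriv (subLaplacian f) [A] r (x * su2_exp A s)) (at s)" if "r \<in> {t/2..t+1}" for r s
      using that t by (intro heat_deriv_Cons sL A) auto
    have "continuous_on ({0..} \<times> UNIV) (\<lambda>(t, x). heat_deriv (subLaplacian f) [A] t x)"
      using A by (intro continuous_on_heat_deriv sL) auto
    moreover have "continuous_on ({t/2..t+1} \<times> UNIV) (\<lambda>p. (fst p, x * su2_exp A (snd p)))"
      by (intro continuous_intros A)
    moreover have "(\<lambda>p. (fst p, x * su2_exp A (snd p))) ` ({t/2..t+1} \<times> UNIV) \<subseteq> {0..} \<times> UNIV"
      using t by auto
    ultimately show "continuous_on ({t/2..t+1} \<times> UNIV) (\<lambda>(t, s). heat_deriv (subLaplacian f) [A] t (x * su2_exp A s))"
      using continuous_on_compose2 by (fastforce simp: split_beta)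
  qed (use t in auto)
  then show ?thesis using A by simp
qed

section \<open>Bochner formulas and positivity\<close>

text \<open>A linear relation between derivatives that holds at all points may be differentiated.\<close>

lemma heat_deriv_Cons_combination:
  assumes f: "smooth_su2 f" and t: "t \<ge> 0" and A: "A \<in> su2_basis"
    and W: "set U \<subseteq> su2_basis" "set V \<subseteq> su2_basis" "set V' \<subseteq> su2_basis"
    and eq: "\<And>x. heat_deriv f U t x = heat_deriv f V t x + c * heat_deriv f V' t x"
  shows "heat_deriv f (A # U) t x = heat_deriv f (A # V) t x + c * heat_deriv f (A # V') t x"
proof -
  have D: "((\<lambda>s. heat_deriv f V t (x * su2_exp A s)) has_real_derivative heat_deriv f (A # V) t x) (at 0)"
    if "set V \<subseteq> su2_basis" for V
    using heat_deriv_Cons[OF f that A t, of x 0] A by simp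
  have "((\<lambda>s. heat_deriv f U t (x * su2_exp A s)) has_real_derivative
      heat_deriv f (A # V) t x + c * heat_deriv f (A # V') t x) (at 0)"
    unfolding eq by (intro DERIV_add DERIV_cmult D W)
  then show ?thesis using D[OF W(1)] DERIV_unique by blast
qed

lemma heat_deriv_subLaplacian_Cons:
  assumes f: "smooth_su2 f" and t: "t \<ge> 0" and A: "A \<in> su2_basis"
  shows "heat_deriv (subLaplacian f) [A] t x = heat_deriv f [A, X, X] t x + heat_deriv f [A, Y, Y] t x"
proof -
  have "((\<lambda>s. heat_deriv f [X, X] t (x * su2_exp A s) + heat_deriv f [Y, Y] t (x * su2_exp A s)) has_real_derivative
      heat_deriv f [A, X, X] t (x * su2_exp A 0) + heat_deriv f [A, Y, Y] t (x * su2_exp A 0)) (at 0)"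
    by (intro DERIV_add heat_deriv_Cons f t A) auto
  moreover have "((\<lambda>s. heat_deriv (subLaplacian f) [] t (x * su2_exp A s)) has_real_derivative
      heat_deriv (subLaplacian f) [A] t (x * su2_exp A 0)) (at 0)"
    by (intro heat_deriv_Cons smooth_su2_subLaplacian f t A) auto
  ultimately show ?thesis using A by (auto simp: heat_deriv_subLaplacian[OF f t] dest: DERIV_unique)
qed

text \<open>The commutators of \<open>L\<close> with the three fields. They follow from \<open>[X, Y] = 2Z\<close>, \<open>[Y, Z] = 2X\<close>,
\<open>[Z, X] = 2Y\<close>; in particular \<open>Z\<close> commutes with \<open>L\<close>.\<close>

lemma heat_deriv_Bochner:
  assumes f: "smooth_su2 f" and t: "t \<ge> 0"
  shows "heat_deriv (subLaplacian f) [X] t x = heat_deriv f [X, X, X] t x + heat_deriv f [Y, Y, X] t x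
      + 4 * heat_deriv f [Y, Z] t x - 4 * heat_deriv f [X] t x"
    and "heat_deriv (subLaplacian f) [Y] t x = heat_deriv f [X, X, Y] t x + heat_deriv f [Y, Y, Y] t x
      - 4 * heat_deriv f [X, Z] t x - 4 * heat_deriv f [Y] t x"
    and "heat_deriv (subLaplacian f) [Z] t x = heat_deriv f [X, X, Z] t x + heat_deriv f [Y, Y, Z] t x"
proof -
  note C = heat_deriv_commutators[OF f _ t]
  have c: "heat_deriv f [X, Y] t x = heat_deriv f [Y, X] t x + 2 * heat_deriv f [Z] t x"
    "heat_deriv f [X, Z] t x = heat_deriv f [Z, X] t x + (- 2) * heat_deriv f [Y] t x"
    "heat_deriv f [Y, Z] t x = heat_deriv f [Z, Y] t x + 2 * heat_deriv f [X] t x" for x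
    using C[of "[]" x] by simp_all
  have d: "heat_deriv f [A, X, Y] t x = heat_deriv f [A, Y, X] t x + 2 * heat_deriv f [A, Z] t x"
    "heat_deriv f [A, X, Z] t x = heat_deriv f [A, Z, X] t x + (- 2) * heat_deriv f [A, Y] t x"
    "heat_deriv f [A, Y, Z] t x = heat_deriv f [A, Z, Y] t x + 2 * heat_deriv f [A, X] t x"
    if "A \<in> su2_basis" for A
    using that by (intro heat_deriv_Cons_combination f t c; simp)+
  note L = heat_deriv_subLaplacian_Cons[OF f t]
  show "heat_deriv (subLaplacian f) [X] t x = heat_deriv f [X, X, X] t x + heat_deriv f [Y, Y, X] t x
      + 4 * heat_deriv f [Y, Z] t x - 4 * heat_deriv f [X] t x"
    using L[of X x] C(1)[of "[Y]" x] d(1)[of Y] c(3)[of x] by simp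
  show "heat_deriv (subLaplacian f) [Y] t x = heat_deriv f [X, X, Y] t x + heat_deriv f [Y, Y, Y] t x
      - 4 * heat_deriv f [X, Z] t x - 4 * heat_deriv f [Y] t x"
    using L[of Y x] C(1)[of "[X]" x] d(1)[of X] c(2)[of x] by simp
  show "heat_deriv (subLaplacian f) [Z] t x = heat_deriv f [X, X, Z] t x + heat_deriv f [Y, Y, Z] t x"
    using L[of Z x] C(3)[of "[X]" x] C(2)[of "[Y]" x] d(2)[of X] d(3)[of Y] c(1)[of x] by simp
qed

lemma heat_deriv_at_0:
  assumes "smooth_su2 f" shows "heat_deriv f [] 0 x = f x"
  using heat_eq_heat_deriv_Nil[OF assms, of 0 x] c0_semigroupD(2)[OF c0]
  by (simp add: bcontfun_su2 smooth_su2_continuous assms)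

lemma heat_deriv_minimum_principle:
  assumes f: "smooth_su2 f" and m: "\<And>x. m \<le> f x" and t: "t \<ge> 0"
  shows "m \<le> heat_deriv f [] t x"
proof -
  have "m - heat_deriv f [] t x \<le> 0"
  proof (rule su2_parabolic_maximum_principle[where T = t
      and G = "\<lambda>t x. m - heat_deriv f [] t x" and Gt = "\<lambda>t x. - heat_deriv (subLaplacian f) [] t x"
      and GX = "\<lambda>t x. - heat_deriv f [X] t x" and GXX = "\<lambda>t x. - heat_deriv f [X, X] t x"
      and GY = "\<lambda>t x. - heat_deriv f [Y] t x" and GYY = "\<lambda>t x. - heat_deriv f [Y, Y] t x"])
    have "continuous_on ({0..t} \<times> UNIV) (\<lambda>(t, x). heat_deriv f [] t x)"
      by (rule continuous_on_subset[OF continuous_on_heat_deriv[OF f]]) auto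
    then show "continuous_on ({0..t} \<times> UNIV) (\<lambda>(t, x). m - heat_deriv f [] t x)"
      unfolding split_beta by (intro continuous_intros)
    show "m - heat_deriv f [] 0 x \<le> 0" for x using m by (simp add: heat_deriv_at_0 f)
    fix r y assume r: "0 < r" "r \<le> t"
    show "((\<lambda>r. m - heat_deriv f [] r y) has_real_derivative - heat_deriv (subLaplacian f) [] r y) (at r)"
      using DERIV_diff[OF DERIV_const heat_deriv_Nil_time[OF f r(1)]] by simp
    have D1: "((\<lambda>s. m - heat_deriv f [] r (y * su2_exp A s)) has_real_derivative - heat_deriv f [A] r (y * su2_exp A s)) (at s)"
      if "A \<in> su2_basis" for A s
      using DERIV_diff[OF DERIV_const heat_deriv_Cons[OF f _ that]] r by simp
    have D2: "((\<lambda>s. - heat_deriv f [A] r (y * su2_exp A s)) has_real_derivative - heat_deriv f [A, A] r y) (at 0)"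
      if "A \<in> su2_basis" for A
      using DERIV_minus[OF heat_deriv_Cons[OF f _ that], of "[A]" r y 0] r that by simp
    show "((\<lambda>s. m - heat_deriv f [] r (y * su2_exp X s)) has_real_derivative - heat_deriv f [X] r (y * su2_exp X s)) (at s)"
      "((\<lambda>s. m - heat_deriv f [] r (y * su2_exp Y s)) has_real_derivative - heat_deriv f [Y] r (y * su2_exp Y s)) (at s)"
      "((\<lambda>s. - heat_deriv f [X] r (y * su2_exp X s)) has_real_derivative - heat_deriv f [X, X] r y) (at 0)"
      "((\<lambda>s. - heat_deriv f [Y] r (y * su2_exp Y s)) has_real_derivative - heat_deriv f [Y, Y] r y) (at 0)" for s
      using D1 D2 by simp_all
    show "- heat_deriv (subLaplacian f) [] r y \<le> - heat_deriv f [X, X] r y + - heat_deriv f [Y, Y] r y"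
      using heat_deriv_subLaplacian[OF f, of r y] r by simp
  qed (use t in auto)
  then show ?thesis by simp
qed

lemma heat_deriv_pos:
  assumes f: "smooth_su2 f" and pos: "\<And>x. f x > 0" and t: "t \<ge> 0"
  shows "heat_deriv f [] t x > 0"
proof -
  obtain x0 where "\<And>x. f x0 \<le> f x"
    using continuous_attains_inf[OF compact_UNIV_su2 _ smooth_su2_continuous[OF f]] by auto
  then have "f x0 \<le> heat_deriv f [] t x" by (rule heat_deriv_minimum_principle[OF f _ t])
  then show ?thesis using pos[of x0] by simp
qed

section \<open>The Li-Yau estimate\<close>

text \<open>The Li-Yau estimate before division by \<open>u\<close>. The choice of the coefficients is dictated by the
conditions \<open>b' = 4a\<close>, \<open>A' = 2a\<gamma>\<close>, \<open>B' = a\<gamma>\<^sup>2\<close> and \<open>a' + 8a\<^sup>2/b - 8a + A' \<le> 0\<close> of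
\<open>li_yau_parabolic_inequality\<close>; with \<open>\<gamma> = 1 - (3\<alpha> - 1) / (2t)\<close> the terms of order \<open>a/t\<close> in the last one
cancel and \<open>-6a\<close> remains.\<close>

lemma li_yau_functional_heat_nonpos:
  fixes \<alpha> :: real
  assumes f: "smooth_su2 f" and pos: "\<And>x. f x > 0" and \<alpha>: "\<alpha> > 2" and T: "T > 0"
  defines "c \<equiv> (3 * \<alpha> - 1) / (\<alpha> - 1)" and "d \<equiv> (3 * \<alpha> - 1)\<^sup>2 / (\<alpha> - 2)"
  shows "li_yau_functional (T powr (\<alpha> - 1)) (4 / \<alpha> * T powr \<alpha>) (2 / \<alpha> * T powr \<alpha> - c * T powr (\<alpha> - 1))
      (1 / \<alpha> * T powr \<alpha> - c * T powr (\<alpha> - 1) + d / 4 * T powr (\<alpha> - 2))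
      (heat_deriv f [] T x) (heat_deriv f [X] T x) (heat_deriv f [Y] T x) (heat_deriv f [Z] T x)
      (heat_deriv (subLaplacian f) [] T x) \<le> 0"
proof -
  define a b A B where "a t = t powr (\<alpha> - 1)" and "b t = 4 / \<alpha> * t powr \<alpha>"
    and "A t = 2 / \<alpha> * t powr \<alpha> - c * t powr (\<alpha> - 1)"
    and "B t = 1 / \<alpha> * t powr \<alpha> - c * t powr (\<alpha> - 1) + d / 4 * t powr (\<alpha> - 2)" for t :: real
  define a1 A1 B1 where "a1 t = (\<alpha> - 1) * t powr (\<alpha> - 1) / t"
    and "A1 t = 2 * a t * (1 - (3 * \<alpha> - 1) / (2 * t))"
    and "B1 t = a t * (1 - (3 * \<alpha> - 1) / (2 * t))\<^sup>2" for t :: real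
  have powr: "t powr \<alpha> = t powr (\<alpha> - 1) * t" "t powr (\<alpha> - 2) = t powr (\<alpha> - 1) / t"
    "t powr (\<alpha> - 3) = t powr (\<alpha> - 1) / t\<^sup>2" if "t > 0" for t :: real
  proof -
    show "t powr \<alpha> = t powr (\<alpha> - 1) * t" using that by (simp add: powr_diff)
    show "t powr (\<alpha> - 2) = t powr (\<alpha> - 1) / t" using that by (simp add: powr_diff power2_eq_square)
    show "t powr (\<alpha> - 3) = t powr (\<alpha> - 1) / t\<^sup>2"
      using that by (simp add: powr_diff power2_eq_square power3_eq_cube)
  qed
  have dpowr: "((\<lambda>t. t powr r) has_real_derivative r * t powr (r - 1)) (at t)" if "t > 0" for t r :: real
    using has_real_derivative_powr[OF that, of r] .
  have c: "c * (\<alpha> - 1) = 3 * \<alpha> - 1" and d: "d * (\<alpha> - 2) = (3 * \<alpha> - 1)\<^sup>2"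
    using \<alpha> by (simp_all add: c_def d_def)
  have Da: "(a has_real_derivative a1 t) (at t)" if "t > 0" for t
    using dpowr[OF that, of "\<alpha> - 1"] powr(2)[OF that] unfolding a_def a1_def by simp
  have Db: "(b has_real_derivative 4 * a t) (at t)" if "t > 0" for t
    using DERIV_cmult[OF dpowr[OF that, of \<alpha>], of "4 / \<alpha>"] \<alpha> unfolding b_def a_def by simp
  have DA: "(A has_real_derivative A1 t) (at t)" if t: "t > 0" for t
  proof -
    have "(A has_real_derivative 2 / \<alpha> * (\<alpha> * t powr (\<alpha> - 1)) - c * ((\<alpha> - 1) * t powr (\<alpha> - 1 - 1))) (at t)"
      unfolding A_def by (intro DERIV_diff DERIV_cmult dpowr t)
    moreover have "2 / \<alpha> * (\<alpha> * t powr (\<alpha> - 1)) - c * ((\<alpha> - 1) * t powr (\<alpha> - 1 - 1)) = A1 t"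
    proof -
      have e: "t powr (\<alpha> - 1 - 1) = t powr (\<alpha> - 1) / t" using powr(2)[OF t] by simp
      show ?thesis
        unfolding A1_def a_def mult.assoc[symmetric] c e using \<alpha> t by (simp add: field_simps)
    qed
    ultimately show ?thesis by simp
  qed
  have DB: "(B has_real_derivative B1 t) (at t)" if t: "t > 0" for t
  proof -
    have "(B has_real_derivative 1 / \<alpha> * (\<alpha> * t powr (\<alpha> - 1)) - c * ((\<alpha> - 1) * t powr (\<alpha> - 1 - 1))
        + d / 4 * ((\<alpha> - 2) * t powr (\<alpha> - 2 - 1))) (at t)"
      unfolding B_def by (intro DERIV_diff DERIV_add DERIV_cmult dpowr t)
    moreover have "1 / \<alpha> * (\<alpha> * t powr (\<alpha> - 1)) - c * ((\<alpha> - 1) * t powr (\<alpha> - 1 - 1))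
        + d / 4 * ((\<alpha> - 2) * t powr (\<alpha> - 2 - 1)) = B1 t"
    proof -
      have e1: "d / 4 * ((\<alpha> - 2) * t powr (\<alpha> - 2 - 1)) = (3 * \<alpha> - 1)\<^sup>2 / 4 * (t powr (\<alpha> - 1) / t\<^sup>2)"
        using powr(3)[OF t] d by (simp add: mult.assoc[symmetric])
      have e2: "c * ((\<alpha> - 1) * t powr (\<alpha> - 1 - 1)) = (3 * \<alpha> - 1) * (t powr (\<alpha> - 1) / t)"
        using powr(2)[OF t] c by (simp add: mult.assoc[symmetric])
      show ?thesis
        unfolding B1_def a_def e1 e2 using \<alpha> t by (simp add: field_simps power2_eq_square)
    qed
    ultimately show ?thesis by simp
  qed
  have cont_powr: "continuous_on {0..T} (\<lambda>t :: real. t powr r)" if "r > 0" for r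
    using that by (intro continuous_on_powr' continuous_intros) auto
  have cab: "continuous_on {0..T} a" "continuous_on {0..T} b" "continuous_on {0..T} A" "continuous_on {0..T} B"
    unfolding a_def b_def A_def B_def using \<alpha> by (auto intro!: continuous_intros cont_powr)
  have cpair: "continuous_on ({0..T} \<times> UNIV) (\<lambda>p :: real \<times> su2. g (fst p))" if "continuous_on {0..T} g" for g :: "real \<Rightarrow> real"
    by (rule continuous_on_compose2[OF that]) (auto intro!: continuous_intros)
  have sL: "smooth_su2 (subLaplacian f)" by (rule smooth_su2_subLaplacian[OF f])
  have upos: "heat_deriv f [] t x > 0" if "t \<ge> 0" for t x
    using heat_deriv_pos[OF f pos that] .
  let ?u = "heat_deriv f" and ?l = "heat_deriv (subLaplacian f)"
  let ?der = "\<lambda>V t x. li_yau_derivative (a t) (b t) (A t) (B t) (?u [] t x) (?u [X] t x) (?u [Y] t x) (?u [Z] t x)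
        (?u [V] t x) (?u [V, X] t x) (?u [V, Y] t x) (?u [V, Z] t x) (?l [V] t x)"
  let ?der2 = "\<lambda>V t x. li_yau_second_derivative (a t) (b t) (A t) (B t) (?u [] t x) (?u [X] t x) (?u [Y] t x) (?u [Z] t x)
        (?u [V] t x) (?u [V, X] t x) (?u [V, Y] t x) (?u [V, Z] t x)
        (?u [V, V] t x) (?u [V, V, X] t x) (?u [V, V, Y] t x) (?u [V, V, Z] t x) (?l [V, V] t x)"
  have "li_yau_functional (a T) (b T) (A T) (B T) (?u [] T x) (?u [X] T x) (?u [Y] T x) (?u [Z] T x) (?l [] T x) \<le> 0"
  proof (rule su2_parabolic_maximum_principle[where T = T
      and G = "\<lambda>t x. li_yau_functional (a t) (b t) (A t) (B t) (?u [] t x) (?u [X] t x) (?u [Y] t x) (?u [Z] t x) (?l [] t x)"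
      and Gt = "\<lambda>t x. li_yau_derivative (a t) (b t) (A t) (B t) (?u [] t x) (?u [X] t x) (?u [Y] t x) (?u [Z] t x)
        (?l [] t x) (?l [X] t x) (?l [Y] t x) (?l [Z] t x) (heat_deriv (subLaplacian (subLaplacian f)) [] t x)
        + li_yau_functional (a1 t) (4 * a t) (A1 t) (B1 t) (?u [] t x) (?u [X] t x) (?u [Y] t x) (?u [Z] t x) (?l [] t x)"
      and GX = "?der X" and GY = "?der Y" and GXX = "?der2 X" and GYY = "?der2 Y"])
    have ch: "continuous_on ({0..T} \<times> UNIV) (\<lambda>p. heat_deriv g W (fst p) (snd p))"
      if "smooth_su2 g" "set W \<subseteq> su2_basis" for g W
    proof -
      have "{0..T} \<times> (UNIV :: su2 set) \<subseteq> {0..} \<times> UNIV" by auto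
      from continuous_on_subset[OF continuous_on_heat_deriv[OF that] this]
      show ?thesis by (simp add: split_beta)
    qed
    show "continuous_on ({0..T} \<times> UNIV)
      (\<lambda>(t, x). li_yau_functional (a t) (b t) (A t) (B t) (?u [] t x) (?u [X] t x) (?u [Y] t x) (?u [Z] t x) (?l [] t x))"
      unfolding split_beta li_yau_functional_def
      by (intro continuous_intros cpair cab ch f sL) (use upos in \<open>auto simp: less_imp_neq[THEN not_sym]\<close>)
    show "li_yau_functional (a 0) (b 0) (A 0) (B 0) (?u [] 0 x) (?u [X] 0 x) (?u [Y] 0 x) (?u [Z] 0 x) (?l [] 0 x) \<le> 0" for x
      by (simp add: li_yau_functional_def a_def b_def A_def B_def)
    fix t x assume t: "0 < t" "t \<le> T"
    then have t0: "t \<ge> 0" by simp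
    have u0: "?u [] t y \<noteq> 0" for y using upos[OF t0] by (simp add: less_imp_neq[THEN not_sym])
    show "((\<lambda>t. li_yau_functional (a t) (b t) (A t) (B t) (?u [] t x) (?u [X] t x) (?u [Y] t x) (?u [Z] t x) (?l [] t x))
      has_real_derivative li_yau_derivative (a t) (b t) (A t) (B t) (?u [] t x) (?u [X] t x) (?u [Y] t x) (?u [Z] t x)
        (?l [] t x) (?l [X] t x) (?l [Y] t x) (?l [Z] t x) (heat_deriv (subLaplacian (subLaplacian f)) [] t x)
        + li_yau_functional (a1 t) (4 * a t) (A1 t) (B1 t) (?u [] t x) (?u [X] t x) (?u [Y] t x) (?u [Z] t x) (?l [] t x)) (at t)"
      by (intro li_yau_functional_has_derivative u0 heat_deriv_Nil_time heat_deriv_singleton_time f sL t su2_basis_mem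
          Da Db DA DB)
    have D: "((\<lambda>s. heat_deriv g W t (x * su2_exp V s)) has_real_derivative heat_deriv g (V # W) t (x * su2_exp V s)) (at s)"
      if "smooth_su2 g" "set W \<subseteq> su2_basis" "V \<in> su2_basis" for g W V s
      using heat_deriv_Cons[OF that(1,2,3) t0] .
    have D1: "((\<lambda>s. li_yau_functional (a t) (b t) (A t) (B t) (?u [] t (x * su2_exp V s)) (?u [X] t (x * su2_exp V s))
        (?u [Y] t (x * su2_exp V s)) (?u [Z] t (x * su2_exp V s)) (?l [] t (x * su2_exp V s)))
      has_real_derivative ?der V t (x * su2_exp V s)) (at s)" if V: "V \<in> su2_basis" for V s
      using li_yau_functional_has_derivative[where s = s and a = "\<lambda>_. a t" and b = "\<lambda>_. b t" and A = "\<lambda>_. A t" and B = "\<lambda>_. B t",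
          OF u0 D[OF f _ V] D[OF f _ V] D[OF f _ V] D[OF f _ V] D[OF sL _ V] DERIV_const DERIV_const DERIV_const DERIV_const]
      by (simp add: li_yau_functional_def)
    have D2: "((\<lambda>s. ?der V t (x * su2_exp V s)) has_real_derivative ?der2 V t (x * su2_exp V 0)) (at 0)"
      if V: "V \<in> su2_basis" for V
      by (intro li_yau_derivative_has_derivative u0 D f sL V) (use V in auto)
    show "((\<lambda>s. li_yau_functional (a t) (b t) (A t) (B t) (?u [] t (x * su2_exp X s)) (?u [X] t (x * su2_exp X s))
        (?u [Y] t (x * su2_exp X s)) (?u [Z] t (x * su2_exp X s)) (?l [] t (x * su2_exp X s)))
      has_real_derivative ?der X t (x * su2_exp X s)) (at s)"
      "((\<lambda>s. li_yau_functional (a t) (b t) (A t) (B t) (?u [] t (x * su2_exp Y s)) (?u [X] t (x * su2_exp Y s))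
        (?u [Y] t (x * su2_exp Y s)) (?u [Z] t (x * su2_exp Y s)) (?l [] t (x * su2_exp Y s)))
      has_real_derivative ?der Y t (x * su2_exp Y s)) (at s)" for s
      by (intro D1 su2_basis_mem)+
    show "((\<lambda>s. ?der X t (x * su2_exp X s)) has_real_derivative ?der2 X t x) (at 0)"
      "((\<lambda>s. ?der Y t (x * su2_exp Y s)) has_real_derivative ?der2 Y t x) (at 0)"
      using D2[of X] D2[of Y] by simp_all
    have at: "a t > 0" using t by (simp add: a_def)
    have bt: "b t = 4 / \<alpha> * (a t * t)" using powr(1)[OF t(1)] by (simp add: a_def b_def)
    show "li_yau_derivative (a t) (b t) (A t) (B t) (?u [] t x) (?u [X] t x) (?u [Y] t x) (?u [Z] t x)
        (?l [] t x) (?l [X] t x) (?l [Y] t x) (?l [Z] t x) (heat_deriv (subLaplacian (subLaplacian f)) [] t x)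
        + li_yau_functional (a1 t) (4 * a t) (A1 t) (B1 t) (?u [] t x) (?u [X] t x) (?u [Y] t x) (?u [Z] t x) (?l [] t x)
      \<le> ?der2 X t x + ?der2 Y t x"
    proof (rule li_yau_parabolic_inequality[where g = "1 - (3 * \<alpha> - 1) / (2 * t)"])
      show "?u [] t x > 0" "a t > 0" using upos t0 at by auto
      show "b t > 0" using bt at t \<alpha> by simp
      have "a1 t + 8 * (a t)\<^sup>2 / b t - 8 * a t + A1 t = - 6 * a t"
        unfolding a1_def A1_def bt a_def[symmetric] using at t \<alpha> by (simp add: field_simps power2_eq_square)
      then show "a1 t + 8 * (a t)\<^sup>2 / b t - 8 * a t + A1 t \<le> 0" using at by simp
      show "?u [X, Y] t x - ?u [Y, X] t x = 2 * ?u [Z] t x"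
        using heat_deriv_commutators(1)[OF f _ t0, of "[]"] by simp
      show "?l [] t x = ?u [X, X] t x + ?u [Y, Y] t x"
        using heat_deriv_subLaplacian[OF f t0] by simp
      show "heat_deriv (subLaplacian (subLaplacian f)) [] t x = ?l [X, X] t x + ?l [Y, Y] t x"
        using heat_deriv_subLaplacian[OF sL t0] by simp
    qed (auto simp: A1_def B1_def heat_deriv_Bochner[OF f t0])
  qed (use T in auto)
  then show ?thesis by (simp add: a_def b_def A_def B_def)
qed

lemma left_inv_field_ln_heat_deriv:
  assumes f: "smooth_su2 f" and pos: "\<And>x. f x > 0" and A: "A \<in> su2_basis" and t: "t \<ge> 0"
  shows "left_inv_field A (\<lambda>y. ln (heat_deriv f [] t y)) x = heat_deriv f [A] t x / heat_deriv f [] t x"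
proof (rule left_inv_fieldI[OF A])
  have "((\<lambda>s. heat_deriv f [] t (x * su2_exp A s)) has_real_derivative heat_deriv f [A] t x) (at 0)"
    using heat_deriv_Cons[OF f _ A t, of "[]" x 0] A by simp
  then have "((\<lambda>s. ln (heat_deriv f [] t (x * su2_exp A s))) has_real_derivative
      1 / heat_deriv f [] t (x * su2_exp A 0) * heat_deriv f [A] t x) (at 0)"
    using heat_deriv_pos[OF f pos t] by (intro DERIV_chain2[OF DERIV_ln_divide]) auto
  then show "((\<lambda>s. ln (heat_deriv f [] t (x * su2_exp A s))) has_real_derivative
      heat_deriv f [A] t x / heat_deriv f [] t x) (at 0)"
    using A by simp
qed

end

theorem theorem4p3:
  fixes P :: "real \<Rightarrow> (su2 \<Rightarrow>\<^sub>C real) \<Rightarrow> (su2 \<Rightarrow>\<^sub>C real)"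
    and f :: "su2 \<Rightarrow>\<^sub>C real"
    and \<alpha> t :: real
    and x :: su2
  assumes "heat_semigroup P"
    and "\<alpha> > 2"
    and "smooth_su2 (apply_bcontfun f)"
    and "\<forall>y. apply_bcontfun f y > 0"
    and "t > 0"
  shows "carre_du_champ (\<lambda>y. ln (apply_bcontfun (P t f) y)) x
      + t / \<alpha> * (left_inv_field su2_Z (\<lambda>y. ln (apply_bcontfun (P t f) y)) x)\<^sup>2
    \<le> ((3 * \<alpha> - 1) / (\<alpha> - 1) - 2 * t / \<alpha>)
        * (subLaplacian (apply_bcontfun (P t f)) x / apply_bcontfun (P t f) x)
      + t / \<alpha> - (3 * \<alpha> - 1) / (\<alpha> - 1) + (3 * \<alpha> - 1)\<^sup>2 / (\<alpha> - 2) * (1 / t)"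
proof -
  interpret su2_heat P using assms(1) by unfold_locales
  note \<alpha> = assms(2) and f = assms(3) and t = assms(5)
  have pos: "apply_bcontfun f y > 0" for y using assms(4) by simp
  have t0: "t \<ge> 0" using t by simp
  define h where "h = heat_deriv (apply_bcontfun f)"
  have Pf: "apply_bcontfun (P t f) = h [] t"
    using heat_eq_heat_deriv_Nil[OF f t0] by (auto simp: h_def Bcontfun_apply)
  have u: "h [] t x > 0" using heat_deriv_pos[OF f pos t0] by (simp add: h_def)
  define l where "l = heat_deriv (subLaplacian (apply_bcontfun f)) [] t x"
  have L: "subLaplacian (h [] t) x = l"
  proof -
    have "subLaplacian (h [] t) x = h [su2_X, su2_X] t x + h [su2_Y, su2_Y] t x"
      by (simp add: subLaplacian_def h_def left_inv_field_heat_deriv[OF f _ _ t0])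
    then show ?thesis by (simp add: h_def l_def heat_deriv_subLaplacian[OF f t0])
  qed
  define c d where "c = (3 * \<alpha> - 1) / (\<alpha> - 1)" and "d = (3 * \<alpha> - 1)\<^sup>2 / (\<alpha> - 2)"
  define w where "w = t powr (\<alpha> - 1)"
  have w: "w > 0" using t by (simp add: w_def)
  have "t powr \<alpha> = w * t" "t powr (\<alpha> - 2) = w / t"
    using t by (simp_all add: w_def powr_diff power2_eq_square)
  then have "li_yau_functional w (4 / \<alpha> * (w * t)) (2 / \<alpha> * (w * t) - c * w) (1 / \<alpha> * (w * t) - c * w + d / 4 * (w / t))
      (h [] t x) (h [su2_X] t x) (h [su2_Y] t x) (h [su2_Z] t x) l \<le> 0"
    using li_yau_functional_heat_nonpos[OF f pos \<alpha> t, of x] unfolding c_def d_def w_def h_def l_def by simp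
  moreover have "li_yau_functional w (4 / \<alpha> * (w * t)) (2 / \<alpha> * (w * t) - c * w) (1 / \<alpha> * (w * t) - c * w + d / 4 * (w / t))
      (h [] t x) (h [su2_X] t x) (h [su2_Y] t x) (h [su2_Z] t x) l
    = w * h [] t x * ((h [su2_X] t x / h [] t x)\<^sup>2 + (h [su2_Y] t x / h [] t x)\<^sup>2
        + 4 * (t / \<alpha> * (h [su2_Z] t x / h [] t x)\<^sup>2)
        - ((c - 2 * t / \<alpha>) * (l / h [] t x) + t / \<alpha> - c + d / 4 * (1 / t)))"
    using u t \<alpha> unfolding li_yau_functional_def by (simp add: field_simps power2_eq_square)
  ultimately have main: "(h [su2_X] t x / h [] t x)\<^sup>2 + (h [su2_Y] t x / h [] t x)\<^sup>2
        + 4 * (t / \<alpha> * (h [su2_Z] t x / h [] t x)\<^sup>2)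
      \<le> (c - 2 * t / \<alpha>) * (l / h [] t x) + t / \<alpha> - c + d / 4 * (1 / t)" (is "?S + 4 * ?k \<le> ?R + ?e")
    using w u by (simp add: mult_le_0_iff)
  have "?k \<ge> 0" using t \<alpha> by simp
  moreover have "k \<le> 4 * k" if "k \<ge> 0" for k :: real using that by simp
  ultimately have "?S + ?k \<le> ?S + 4 * ?k" by (intro add_left_mono) blast
  also note main
  also have "?e \<le> d * (1 / t)" using t \<alpha> by (simp add: d_def field_simps)
  finally have "?S + ?k \<le> ?R + d * (1 / t)" by simp
  then show ?thesis
    unfolding Pf L carre_du_champ_def
    by (simp add: h_def c_def d_def left_inv_field_ln_heat_deriv[OF f pos _ t0])
qed

end
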